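(* $\textsc{CRLE}$ polynomial-time reduces to $\textsc{FlatLE}_0$. More precisely, given a poset $P=(X,\prec)$ on $n$ elements, a poset $Q=(Y,\prec')$ on $m$ elements, $x\in\min(P)$ and $y\in\min(Q)$, one can construct in polynomial time a poset $R=(Z,\prec^\circ)$ on $\ell=|Z|=m+n$ elements, an element $z\in Z$ and $c\in[\ell]$, such that $\mathrm{N}(R,z,c)=\mathrm{N}(R,z,c+1)$ if and only if $\rho(P,x)=\rho(Q,y)$.
   Context: For a finite poset $P$, $e(P)$ is its number of linear extensions (bijections $f:X\to[|X|]$ with $f(u)<f(v)$ whenever $u\prec v$); for $x\in\min(P)$ (a minimal element), $\rho(P,x):=e(P)/e(P-x)$. $\mathrm{N}(R,z,c)$ is the number of linear extensions $f$ of $R$ with $f(z)=c$. $\textsc{CRLE}$ asks whether $\rho(P,x)=\rho(Q,y)$; $\textsc{FlatLE}_0$ asks whether $\mathrm{N}(R,z,c)=\mathrm{N}(R,z,c+1)$. *)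

theory Defs
  imports Complex_Main "HOL-Library.FuncSet"
begin

section \<open>Finite posets and linear extensions\<close>

text \<open>A poset \<open>(X, lt)\<close> is given by its ground set and its strict order relation.\<close>

type_synonym 'a poset = "'a set \<times> ('a \<times> 'a) set"

definition finite_poset :: "'a poset \<Rightarrow> bool" where
  "finite_poset P \<longleftrightarrow>
     (case P of (X, lt) \<Rightarrow> finite X \<and> lt \<subseteq> X \<times> X \<and> irrefl lt \<and> trans lt)"

definition min_elems :: "'a poset \<Rightarrow> 'a set" where
  "min_elems P = (case P of (X, lt) \<Rightarrow> {x \<in> X. \<forall>u\<in>X. (u, x) \<notin> lt})"

definition delete_elem :: "'a poset \<Rightarrow> 'a \<Rightarrow> 'a poset" where
  "delete_elem P x =
     (case P of (X, lt) \<Rightarrow> (X - {x}, lt \<inter> ((X - {x}) \<times> (X - {x}))))"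

text \<open>
  Linear extensions are taken as extensional functions (fixed to \<open>undefined\<close> outside the ground
  set), so that the cardinality counts the bijections of the ground set.
\<close>

definition lin_exts :: "'a poset \<Rightarrow> ('a \<Rightarrow> nat) set" where
  "lin_exts P =
     (case P of (X, lt) \<Rightarrow>
        {f \<in> extensional X. bij_betw f X {1..card X} \<and> (\<forall>(u, v)\<in>lt. f u < f v)})"

definition num_lin_exts :: "'a poset \<Rightarrow> nat" where
  "num_lin_exts P = card (lin_exts P)"

definition rho :: "'a poset \<Rightarrow> 'a \<Rightarrow> rat" where
  "rho P x = of_nat (num_lin_exts P) / of_nat (num_lin_exts (delete_elem P x))"

definition num_lin_exts_at :: "'a poset \<Rightarrow> 'a \<Rightarrow> nat \<Rightarrow> nat" where
  "num_lin_exts_at R z c = card {f \<in> lin_exts R. f z = c}"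


section \<open>Polynomial-time computation\<close>

text \<open>
  Deterministic multi-tape Turing machines. Tapes are infinite to the right, with cells numbered
  from 0, and symbols are natural numbers below \<open>tm_syms\<close>: 0 is the blank, 1 marks the left end of
  a tape initially, 2 and 3 stand for the bits 0 and 1, and larger symbols may be used freely.
  States are \<open>0, \<dots>, tm_states\<close>; 0 is the start state and \<open>tm_states\<close> is the halting state.
  The transition function maps a state and the list of scanned symbols to the next state and a
  list giving, for each tape, the symbol to write and the head movement.
\<close>

datatype head_move = Go_Left | Stay | Go_Right

type_synonym tape = "(nat \<Rightarrow> nat) \<times> nat"
type_synonym config = "nat \<times> tape list"

record turing_machine =
  tm_tapes :: nat
  tm_syms :: nat
  tm_states :: nat
  tm_delta :: "nat \<Rightarrow> nat list \<Rightarrow> nat \<times> (nat \<times> head_move) list"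

definition wf_tm :: "turing_machine \<Rightarrow> bool" where
  "wf_tm M \<longleftrightarrow>
     tm_tapes M \<ge> 1 \<and> tm_syms M \<ge> 4 \<and>
     (\<forall>q < tm_states M. \<forall>ss. length ss = tm_tapes M \<and> set ss \<subseteq> {..<tm_syms M} \<longrightarrow>
        (case tm_delta M q ss of (q', as) \<Rightarrow>
           q' \<le> tm_states M \<and> length as = tm_tapes M \<and> fst ` set as \<subseteq> {..<tm_syms M}))"

text \<open>A move to the left from cell 0 leaves the head where it is.\<close>

fun tape_act :: "nat \<times> head_move \<Rightarrow> tape \<Rightarrow> tape" where
  "tape_act (s, mv) (t, i) =
     (t(i := s), case mv of Go_Left \<Rightarrow> i - 1 | Stay \<Rightarrow> i | Go_Right \<Rightarrow> i + 1)"

fun tm_step :: "turing_machine \<Rightarrow> config \<Rightarrow> config" where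
  "tm_step M (q, ts) =
     (if q = tm_states M then (q, ts)
      else case tm_delta M q (map (\<lambda>(t, i). t i) ts) of
             (q', as) \<Rightarrow> (q', map2 tape_act as ts))"

definition tape_content :: "bool list \<Rightarrow> nat \<Rightarrow> nat" where
  "tape_content w i =
     (if i = 0 then 1
      else if i \<le> length w then (if w ! (i - 1) then 3 else 2)
      else 0)"

definition start_config :: "turing_machine \<Rightarrow> bool list \<Rightarrow> config" where
  "start_config M w =
     (0, (tape_content w, 0) # replicate (tm_tapes M - 1) (tape_content [], 0))"

text \<open>The input is on the first tape and the output on the last one.\<close>

definition tm_outputs_within :: "turing_machine \<Rightarrow> bool list \<Rightarrow> bool list \<Rightarrow> nat \<Rightarrow> bool" where
  "tm_outputs_within M w v T \<longleftrightarrow>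
     (\<exists>k\<le>T. \<exists>ts. (tm_step M ^^ k) (start_config M w) = (tm_states M, ts) \<and>
                 fst (last ts) = tape_content v)"

text \<open>
  \<open>f\<close> is computed on the instances in \<open>D\<close> by one machine, in time polynomial in the length of the
  encoded instance.
\<close>

definition poly_time_computable ::
  "'a set \<Rightarrow> ('a \<Rightarrow> bool list) \<Rightarrow> ('b \<Rightarrow> bool list) \<Rightarrow> ('a \<Rightarrow> 'b) \<Rightarrow> bool" where
  "poly_time_computable D enc_in enc_out f \<longleftrightarrow>
     (\<exists>M c d. wf_tm M \<and>
        (\<forall>a\<in>D. tm_outputs_within M (enc_in a) (enc_out (f a)) (c * length (enc_in a) ^ d + c)))"

text \<open>
  A decision problem consists of its instances, those with answer yes, and the encoding of
  instances by bit strings.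
\<close>

record 'a problem =
  instances :: "'a set"
  yes_instances :: "'a set"
  encoding :: "'a \<Rightarrow> bool list"

definition poly_time_reduces :: "'a problem \<Rightarrow> 'b problem \<Rightarrow> bool" where
  "poly_time_reduces A B \<longleftrightarrow>
     (\<exists>f. poly_time_computable (instances A) (encoding A) (encoding B) f \<and>
          (\<forall>a\<in>instances A. f a \<in> instances B \<and>
             (f a \<in> yes_instances B \<longleftrightarrow> a \<in> yes_instances A)))"


section \<open>The two decision problems\<close>

text \<open>
  As inputs and outputs of algorithms, posets on \<open>n\<close> elements have ground set \<open>{..<n}\<close>. They are
  encoded by \<open>n\<close> in unary followed by the row-major 0-1 matrix of the strict order; elements and
  positions are encoded in unary.
\<close>

definition labelled_poset :: "nat \<Rightarrow> nat poset \<Rightarrow> bool" where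
  "labelled_poset n P \<longleftrightarrow> fst P = {..<n} \<and> finite_poset P"

definition enc_nat :: "nat \<Rightarrow> bool list" where
  "enc_nat n = replicate n True @ [False]"

definition enc_poset :: "nat poset \<Rightarrow> bool list" where
  "enc_poset P =
     (let n = card (fst P)
      in enc_nat n @ concat (map (\<lambda>i. map (\<lambda>j. (i, j) \<in> snd P) [0..<n]) [0..<n]))"

definition crle_instances :: "(nat poset \<times> nat poset \<times> nat \<times> nat) set" where
  "crle_instances =
     {(P, Q, x, y). (\<exists>n. labelled_poset n P) \<and> (\<exists>m. labelled_poset m Q) \<and>
        x \<in> min_elems P \<and> y \<in> min_elems Q}"

definition enc_crle :: "nat poset \<times> nat poset \<times> nat \<times> nat \<Rightarrow> bool list" where
  "enc_crle = (\<lambda>(P, Q, x, y). enc_poset P @ enc_poset Q @ enc_nat x @ enc_nat y)"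

definition CRLE :: "(nat poset \<times> nat poset \<times> nat \<times> nat) problem" where
  "CRLE =
     \<lparr>instances = crle_instances,
      yes_instances = {(P, Q, x, y) \<in> crle_instances. rho P x = rho Q y},
      encoding = enc_crle\<rparr>"

definition flatle_instances :: "(nat poset \<times> nat \<times> nat) set" where
  "flatle_instances =
     {(R, z, c). \<exists>l. labelled_poset l R \<and> z \<in> fst R \<and> c \<in> {1..l}}"

definition enc_flatle :: "nat poset \<times> nat \<times> nat \<Rightarrow> bool list" where
  "enc_flatle = (\<lambda>(R, z, c). enc_poset R @ enc_nat z @ enc_nat c)"

definition FlatLE0 :: "(nat poset \<times> nat \<times> nat) problem" where
  "FlatLE0 =
     \<lparr>instances = flatle_instances,
      yes_instances =
        {(R, z, c) \<in> flatle_instances. num_lin_exts_at R z c = num_lin_exts_at R z (c + 1)},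
      encoding = enc_flatle\<rparr>"

end

theory Submission
  imports Defs
begin

text \<open>
  Put the dual of \<open>P - x\<close> entirely below \<open>Q - y\<close>, add an element \<open>s\<close> that plays the role of \<open>x\<close> towards
  the lower part and of \<open>y\<close> towards the upper part, and an element \<open>w\<close> between the two parts that is
  incomparable to \<open>s\<close>. If \<open>w\<close> is in position \<open>n = |P|\<close>, then \<open>s\<close> comes after \<open>w\<close> and the two sides are
  independent, which gives \<open>e(P - x) e(Q)\<close> linear extensions; if \<open>w\<close> is in position \<open>n + 1\<close>, then \<open>s\<close>
  comes before \<open>w\<close> and the count is \<open>e(P) e(Q - y)\<close>. Equality of the two numbers is \<open>\<rho>(P, x) = \<rho>(Q, y)\<close>.

  The matrix of this poset is written by a Turing machine that is compiled from a structured program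
  in which every loop is driven by a unary counter on its own tape. If no loop makes more than \<open>B\<close>
  iterations, the running time is bounded by a polynomial in \<open>B\<close> that depends only on the program text.
\<close>


section \<open>Counting linear extensions\<close>

text \<open>Dualizing \<open>P\<close> makes \<open>x\<close> maximal in the lower part while
  \<open>y\<close> stays minimal in the upper one, so a single element can carry the relations of
  both: a chain through it only says that a lower element precedes an upper one, which holds anyway.
  That element is the only one incomparable to \<open>w\<close>, which has n - 1 elements below it
  and m - 1 above. Hence n and n + 1 are the only possible positions of \<open>w\<close>, and each
  amounts to saying which labels fill the first n positions. The two products are the cross products
  of the two quotients; going back to quotients needs nonzero denominators, that is, the existence
  of linear extensions. For the machine, the difficulty is to keep time out of the correctness
  arguments. Programs are therefore verified as state transformers, and time enters only through the
  bound \<open>B\<close> on iterations, finally taken as the input length plus one.\<close>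

lemma lin_exts_memD:
  assumes "f \<in> lin_exts (X, lt)"
  shows "f \<in> extensional X" "bij_betw f X {1..card X}" "\<And>u v. (u, v) \<in> lt \<Longrightarrow> f u < f v"
  using assms by (auto simp: lin_exts_def)

lemma lin_exts_range:
  assumes "f \<in> lin_exts (X, lt)" "v \<in> X"
  shows "1 \<le> f v" "f v \<le> card X"
  using bij_betwE[OF lin_exts_memD(2)[OF assms(1)]] assms(2) by auto

lemma finite_lin_exts:
  assumes "finite X"
  shows "finite (lin_exts (X, lt))"
proof (rule finite_subset)
  show "lin_exts (X, lt) \<subseteq> X \<rightarrow>\<^sub>E {1..card X}"
    by (auto simp: lin_exts_def PiE_def bij_betw_def)
  show "finite (X \<rightarrow>\<^sub>E {1..card X})"
    using assms by (intro finite_PiE) auto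
qed

text \<open>Linear extensions of the target pull back along \<open>\<phi>\<close>, injectively
  because \<open>\<phi>\<close> is onto. Stated as an inequality, it can be applied to
  \<open>\<phi>\<close> and to its inverse to give invariance under isomorphism.\<close>

lemma num_lin_exts_le_iso:
  assumes "finite X" "bij_betw \<phi> X X'" "lt \<subseteq> X \<times> X"
    and "\<And>u v. (u, v) \<in> lt \<Longrightarrow> (\<phi> u, \<phi> v) \<in> lt'"
  shows "num_lin_exts (X', lt') \<le> num_lin_exts (X, lt)"
  unfolding num_lin_exts_def
proof (rule card_inj_on_le)
  have X': "X' = \<phi> ` X" and card: "card X' = card X"
    using assms(2) by (auto simp: bij_betw_def card_image)
  show "inj_on (\<lambda>f. restrict (f \<circ> \<phi>) X) (lin_exts (X', lt'))"
  proof (rule inj_onI)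
    fix f g assume f: "f \<in> lin_exts (X', lt')" and g: "g \<in> lin_exts (X', lt')"
      and eq: "restrict (f \<circ> \<phi>) X = restrict (g \<circ> \<phi>) X"
    show "f = g"
    proof (rule extensionalityI)
      show "f \<in> extensional X'" "g \<in> extensional X'"
        using f g by (auto dest: lin_exts_memD)
      fix v assume "v \<in> X'"
      then obtain u where "u \<in> X" "v = \<phi> u" using X' by auto
      with fun_cong[OF eq, of u] show "f v = g v" by simp
    qed
  qed
  show "(\<lambda>f. restrict (f \<circ> \<phi>) X) ` lin_exts (X', lt') \<subseteq> lin_exts (X, lt)"
  proof safe
    fix f assume f: "f \<in> lin_exts (X', lt')"
    have "bij_betw (restrict (f \<circ> \<phi>) X) X {1..card X}"
      using bij_betw_trans[OF assms(2) lin_exts_memD(2)[OF f]] unfolding card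
      by (simp add: o_def cong: bij_betw_cong)
    moreover have "restrict (f \<circ> \<phi>) X u < restrict (f \<circ> \<phi>) X v" if "(u, v) \<in> lt" for u v
      using lin_exts_memD(3)[OF f assms(4)[OF that]] that assms(3) by auto
    ultimately show "restrict (f \<circ> \<phi>) X \<in> lin_exts (X, lt)"
      unfolding lin_exts_def by blast
  qed
  show "finite (lin_exts (X, lt))" by (rule finite_lin_exts[OF assms(1)])
qed

lemma num_lin_exts_iso:
  assumes "finite X" "bij_betw \<phi> X X'" "lt \<subseteq> X \<times> X" "lt' \<subseteq> X' \<times> X'"
    and "\<And>u v. u \<in> X \<Longrightarrow> v \<in> X \<Longrightarrow> (\<phi> u, \<phi> v) \<in> lt' \<longleftrightarrow> (u, v) \<in> lt"
  shows "num_lin_exts (X', lt') = num_lin_exts (X, lt)"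
proof (rule antisym)
  show "num_lin_exts (X', lt') \<le> num_lin_exts (X, lt)"
    using assms by (intro num_lin_exts_le_iso[of _ \<phi>]) auto
  have inv: "bij_betw (inv_into X \<phi>) X' X" by (rule bij_betw_inv_into[OF assms(2)])
  show "num_lin_exts (X, lt) \<le> num_lin_exts (X', lt')"
  proof (rule num_lin_exts_le_iso[OF _ inv assms(4)])
    show "finite X'" using assms(1,2) bij_betw_finite by blast
    fix u v assume uv: "(u, v) \<in> lt'"
    then have "u \<in> X'" "v \<in> X'" using assms(4) by auto
    then show "(inv_into X \<phi> u, inv_into X \<phi> v) \<in> lt"
      using uv assms(5)[of "inv_into X \<phi> u" "inv_into X \<phi> v"] bij_betwE[OF inv]
        bij_betw_inv_into_right[OF assms(2)] by auto
  qed
qed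

text \<open>Reading positions backwards, from \<open>i\<close> to \<open>card X + 1 - i\<close>,
  reverses the order. The truncated subtraction is harmless since positions lie in
  \<open>{1..card X}\<close>.\<close>

lemma num_lin_exts_le_converse:
  assumes "finite X" "lt \<subseteq> X \<times> X"
  shows "num_lin_exts (X, lt) \<le> num_lin_exts (X, lt\<inverse>)"
  unfolding num_lin_exts_def
proof (rule card_inj_on_le)
  let ?r = "\<lambda>f. \<lambda>v\<in>X. card X + 1 - f v"
  show "inj_on ?r (lin_exts (X, lt))"
  proof (rule inj_onI)
    fix f g assume f: "f \<in> lin_exts (X, lt)" and g: "g \<in> lin_exts (X, lt)" and eq: "?r f = ?r g"
    show "f = g"
    proof (rule extensionalityI)
      show "f \<in> extensional X" "g \<in> extensional X"
        using f g by (auto dest: lin_exts_memD)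
      fix v assume v: "v \<in> X"
      with fun_cong[OF eq, of v] lin_exts_range[OF f v] lin_exts_range[OF g v]
      show "f v = g v" by simp
    qed
  qed
  show "?r ` lin_exts (X, lt) \<subseteq> lin_exts (X, lt\<inverse>)"
  proof safe
    fix f assume f: "f \<in> lin_exts (X, lt)"
    have "bij_betw (\<lambda>i. card X + 1 - i) {1..card X} {1..card X}"
      by (rule bij_betw_byWitness[where f' = "\<lambda>i. card X + 1 - i"]) auto
    then have "bij_betw ((\<lambda>i. card X + 1 - i) \<circ> f) X {1..card X}"
      using bij_betw_trans[OF lin_exts_memD(2)[OF f]] by blast
    then have "bij_betw (?r f) X {1..card X}"
      by (simp cong: bij_betw_cong)
    moreover have "?r f v < ?r f u" if "(u, v) \<in> lt" for u v
    proof -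
      have "u \<in> X" "v \<in> X" using that assms(2) by auto
      then show ?thesis
        using lin_exts_memD(3)[OF f that] lin_exts_range[OF f] by (simp add: diff_less_mono2 less_Suc_eq_le)
    qed
    ultimately show "?r f \<in> lin_exts (X, lt\<inverse>)"
      unfolding lin_exts_def by blast
  qed
  show "finite (lin_exts (X, lt\<inverse>))" by (rule finite_lin_exts[OF assms(1)])
qed

lemma num_lin_exts_converse:
  assumes "finite X" "lt \<subseteq> X \<times> X"
  shows "num_lin_exts (X, lt\<inverse>) = num_lin_exts (X, lt)"
  using num_lin_exts_le_converse[OF assms] num_lin_exts_le_converse[of X "lt\<inverse>"] assms by auto

lemma bij_betw_remaining:
  fixes f :: "'a \<Rightarrow> nat"
  assumes "bij_betw f (A \<union> B) {1..N}" "A \<inter> B = {}" "f ` A = {1..k}"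
  shows "f ` B = {k + 1..N}"
proof -
  have "f ` B = f ` (A \<union> B) - f ` A"
    using assms(1,2) unfolding bij_betw_def inj_on_def by blast
  also have "f ` (A \<union> B) = {1..N}" using assms(1) by (simp add: bij_betw_def)
  finally show ?thesis using assms(3) by auto
qed

text \<open>The source of every product formula below: once \<open>A\<close> fills the first
  \<open>card A\<close> positions, relations from \<open>A\<close> to \<open>B\<close> hold
  automatically and none go back, so the two parts can be extended independently.\<close>

lemma card_lin_exts_split:
  assumes fin: "finite A" "finite B" and disj: "A \<inter> B = {}"
    and lt: "lt \<subseteq> (A \<union> B) \<times> (A \<union> B)"
    and no: "\<And>a b. a \<in> A \<Longrightarrow> b \<in> B \<Longrightarrow> (b, a) \<notin> lt"
  shows "card {f \<in> lin_exts (A \<union> B, lt). f ` A = {1..card A}} =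
    num_lin_exts (A, lt \<inter> A \<times> A) * num_lin_exts (B, lt \<inter> B \<times> B)"
proof -
  let ?k = "card A"
  let ?S = "{f \<in> lin_exts (A \<union> B, lt). f ` A = {1..?k}}"
  let ?T = "lin_exts (A, lt \<inter> A \<times> A) \<times> lin_exts (B, lt \<inter> B \<times> B)"
  let ?to = "\<lambda>f. (restrict f A, \<lambda>v\<in>B. f v - ?k)"
  let ?from = "\<lambda>(g, h). \<lambda>v\<in>A \<union> B. if v \<in> A then g v else ?k + h v"
  have card: "card (A \<union> B) = ?k + card B"
    using fin disj by (rule card_Un_disjoint)
  have "bij_betw ?to ?S ?T"
  proof (rule bij_betw_byWitness[where f' = ?from])
    \<comment> \<open>Positions of \<open>B\<close> exceed \<open>?k\<close>, so the shift
      \<open>f v - ?k\<close> is a true subtraction and can be undone.\<close>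
    have rangeB: "f v > ?k" if "f \<in> ?S" "v \<in> B" for f v
    proof -
      have "f ` B = {?k + 1..card (A \<union> B)}"
        using that(1) disj lin_exts_memD(2) by (intro bij_betw_remaining[of f A]) blast+
      then have "f v \<in> {?k + 1..card (A \<union> B)}"
        using that(2) by blast
      then show ?thesis by simp
    qed
    show "\<forall>f\<in>?S. ?from (?to f) = f"
    proof
      fix f assume f: "f \<in> ?S"
      then have "f \<in> extensional (A \<union> B)" using lin_exts_memD(1) by blast
      then show "?from (?to f) = f"
        using rangeB[OF f] by (auto simp: fun_eq_iff extensional_def less_imp_le)
    qed
    show "\<forall>p\<in>?T. ?to (?from p) = p"
    proof
      fix p assume "p \<in> ?T"
      then obtain g h where p: "p = (g, h)" and "g \<in> extensional A" "h \<in> extensional B"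
        using lin_exts_memD(1) by blast
      then show "?to (?from p) = p"
        using disj by (auto simp: fun_eq_iff extensional_def restrict_def)
    qed
    show "?to ` ?S \<subseteq> ?T"
    proof
      fix p assume "p \<in> ?to ` ?S"
      then obtain f where f: "f \<in> ?S" and p: "p = ?to f" by blast
      then have f': "f \<in> lin_exts (A \<union> B, lt)" and fA: "f ` A = {1..?k}" by auto
      have inj: "inj_on f (A \<union> B)" using lin_exts_memD(2)[OF f'] by (simp add: bij_betw_def)
      have "bij_betw (restrict f A) A {1..?k}"
        using inj fA by (auto simp: bij_betw_def inj_on_def)
      then have "restrict f A \<in> lin_exts (A, lt \<inter> A \<times> A)"
        using lin_exts_memD(3)[OF f'] by (auto simp: lin_exts_def)
      moreover have "(\<lambda>v\<in>B. f v - ?k) \<in> lin_exts (B, lt \<inter> B \<times> B)"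
      proof -
        have fB: "f ` B = {?k + 1..?k + card B}"
          using bij_betw_remaining[OF lin_exts_memD(2)[OF f'] disj fA] card by simp
        have "(\<lambda>v. f v - ?k) ` B = (\<lambda>i. i - ?k) ` {?k + 1..?k + card B}"
          unfolding fB[symmetric] by (simp add: image_image)
        also have "\<dots> = {1..card B}"
        proof (intro subset_antisym subsetI)
          fix i assume "i \<in> {1..card B}"
          then show "i \<in> (\<lambda>i. i - ?k) ` {?k + 1..?k + card B}"
            by (intro image_eqI[of _ _ "?k + i"]) auto
        qed auto
        finally have "(\<lambda>v. f v - ?k) ` B = {1..card B}" .
        moreover have "inj_on (\<lambda>v. f v - ?k) B"
        proof (rule inj_onI)
          fix u v assume uv: "u \<in> B" "v \<in> B" "f u - ?k = f v - ?k"
          then have "f u = f v" using rangeB[OF f, of u] rangeB[OF f, of v] by simp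
          then show "u = v" using uv inj by (auto simp: inj_on_def)
        qed
        ultimately have "bij_betw (\<lambda>v\<in>B. f v - ?k) B {1..card B}"
          by (auto simp: bij_betw_def inj_on_def)
        then show ?thesis
          using lin_exts_memD(3)[OF f'] rangeB[OF f] by (auto simp: lin_exts_def diff_less_mono less_imp_le)
      qed
      ultimately show "p \<in> ?T" using p by blast
    qed
    show "?from ` ?T \<subseteq> ?S"
    proof
      fix f assume "f \<in> ?from ` ?T"
      then obtain g h where g: "g \<in> lin_exts (A, lt \<inter> A \<times> A)" and h: "h \<in> lin_exts (B, lt \<inter> B \<times> B)"
        and f: "f = ?from (g, h)" by blast
      have fa: "f v = g v" if "v \<in> A" for v using that f by simp
      have fb: "f v = ?k + h v" if "v \<in> B" for v using that f disj by auto
      have A: "bij_betw f A {1..?k}"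
        using lin_exts_memD(2)[OF g] fa by (simp cong: bij_betw_cong)
      have "bij_betw (\<lambda>i. ?k + i) {1..card B} {?k + 1..?k + card B}"
        by (rule bij_betw_byWitness[where f' = "\<lambda>i. i - ?k"]) auto
      then have "bij_betw ((\<lambda>i. ?k + i) \<circ> h) B {?k + 1..?k + card B}"
        using bij_betw_trans[OF lin_exts_memD(2)[OF h]] by blast
      then have "bij_betw f B {?k + 1..?k + card B}"
        using fb by (simp cong: bij_betw_cong)
      then have "bij_betw f (A \<union> B) ({1..?k} \<union> {?k + 1..?k + card B})"
        using A by (rule_tac bij_betw_combine) auto
      moreover have "{1..?k} \<union> {?k + 1..?k + card B} = {1..card (A \<union> B)}"
        unfolding card by auto
      ultimately have "bij_betw f (A \<union> B) {1..card (A \<union> B)}" by simp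
      moreover have "f \<in> extensional (A \<union> B)" using f by simp
      moreover have "f u < f v" if uv: "(u, v) \<in> lt" for u v
      proof -
        consider "u \<in> A" "v \<in> A" | "u \<in> A" "v \<in> B" | "u \<in> B" "v \<in> B"
          using uv lt no by blast
        then show ?thesis
        proof cases
          case 1
          then show ?thesis using lin_exts_memD(3)[OF g] uv fa by auto
        next
          case 2
          then show ?thesis
            using lin_exts_range[OF g, of u] lin_exts_range[OF h, of v] fa fb by auto
        next
          case 3
          then show ?thesis using lin_exts_memD(3)[OF h] uv fb by auto
        qed
      qed
      moreover have "f ` A = {1..?k}" using A by (simp add: bij_betw_def)
      ultimately show "f \<in> ?S" by (auto simp: lin_exts_def)
    qed
  qed
  then show ?thesis
    unfolding num_lin_exts_def by (simp add: bij_betw_same_card card_cartesian_product)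
qed

section \<open>Greatest and least elements, and existence of linear extensions\<close>

lemma num_lin_exts_singleton: "num_lin_exts ({v}, {}) = 1"
proof -
  have "lin_exts ({v}, {}) = {\<lambda>u\<in>{v}. 1}"
    by (auto simp: lin_exts_def bij_betw_def extensional_def fun_eq_iff)
  then show ?thesis by (simp add: num_lin_exts_def)
qed

text \<open>The image of \<open>A\<close> is downward closed in \<open>{1..N}\<close>, since a
  smaller position held by \<open>B\<close> would contradict the hypothesis. A position
  \<open>i\<close> in it thus brings \<open>{1..i}\<close> along, so \<open>i \<le> card A\<close>,
  and counting gives equality.\<close>

lemma initial_segment_image:
  fixes f :: "'a \<Rightarrow> nat"
  assumes "finite A" "bij_betw f (A \<union> B) {1..N}" "\<And>a b. a \<in> A \<Longrightarrow> b \<in> B \<Longrightarrow> f a < f b"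
  shows "f ` A = {1..card A}"
proof -
  have inj: "inj_on f A" using assms(2) by (auto simp: bij_betw_def inj_on_def)
  have sub: "f ` A \<subseteq> {1..N}" using assms(2) by (auto simp: bij_betw_def)
  have down: "i \<in> f ` A" if "a \<in> A" "1 \<le> i" "i \<le> f a" for a i
  proof -
    have "i \<in> {1..N}" using that sub by force
    then have "i \<in> f ` (A \<union> B)" using assms(2) by (simp add: bij_betw_def)
    then obtain c where "c \<in> A \<union> B" "f c = i" by blast
    then show ?thesis using assms(3)[OF that(1), of c] that(3) by auto
  qed
  have "f ` A \<subseteq> {1..card A}"
  proof
    fix i assume "i \<in> f ` A"
    then obtain a where a: "a \<in> A" "i = f a" by blast
    then have "{1..i} \<subseteq> f ` A" using down by auto
    then have "card {1..i} \<le> card (f ` A)" using assms(1) by (intro card_mono) auto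
    then show "i \<in> {1..card A}" using a sub inj by (auto simp: card_image)
  qed
  then show ?thesis
    using inj by (intro card_subset_eq) (auto simp: card_image)
qed

text \<open>A greatest element comes last in every extension, so \<open>card_lin_exts_split\<close>
  counts all extensions, with a one-point second part. This strips \<open>w\<close> off the lower
  part.\<close>

lemma num_lin_exts_top:
  assumes "finite A" "t \<notin> A" "lt \<subseteq> insert t A \<times> insert t A"
    and "\<And>a. a \<in> A \<Longrightarrow> (a, t) \<in> lt" "\<And>a. (t, a) \<notin> lt"
  shows "num_lin_exts (insert t A, lt) = num_lin_exts (A, lt \<inter> A \<times> A)"
proof -
  have "f ` A = {1..card A}" if "f \<in> lin_exts (A \<union> {t}, lt)" for f
    using lin_exts_memD(3)[OF that] assms(1,4)
    by (intro initial_segment_image[OF _ lin_exts_memD(2)[OF that]]) auto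
  then have eq: "{f \<in> lin_exts (A \<union> {t}, lt). f ` A = {1..card A}} = lin_exts (A \<union> {t}, lt)"
    by blast
  have "lt \<inter> {t} \<times> {t} = {}" using assms(5) by auto
  then show ?thesis
    using card_lin_exts_split[of A "{t}" lt] assms eq
    by (simp add: num_lin_exts_singleton) (simp add: num_lin_exts_def)
qed

text \<open>The dual, through the converse order; it strips \<open>w\<close> off the upper
  part.\<close>

lemma num_lin_exts_bot:
  assumes "finite A" "t \<notin> A" "lt \<subseteq> insert t A \<times> insert t A"
    and "\<And>a. a \<in> A \<Longrightarrow> (t, a) \<in> lt" "\<And>a. (a, t) \<notin> lt"
  shows "num_lin_exts (insert t A, lt) = num_lin_exts (A, lt \<inter> A \<times> A)"
proof -
  have "num_lin_exts (insert t A, lt) = num_lin_exts (insert t A, lt\<inverse>)"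
    using assms by (intro num_lin_exts_converse[symmetric]) auto
  also have "\<dots> = num_lin_exts (A, lt\<inverse> \<inter> A \<times> A)"
    using assms by (intro num_lin_exts_top) auto
  also have "lt\<inverse> \<inter> A \<times> A = (lt \<inter> A \<times> A)\<inverse>" by auto
  also have "num_lin_exts (A, \<dots>) = num_lin_exts (A, lt \<inter> A \<times> A)"
    using assms(1) by (intro num_lin_exts_converse) auto
  finally show ?thesis .
qed

text \<open>Needed for the denominators in \<open>rho\<close>. Induction removes a maximal element
  \<open>t\<close>; the extensions that place \<open>t\<close> last are as many as those of the
  rest.\<close>

lemma num_lin_exts_pos:
  assumes "finite X" "irrefl lt" "trans lt" "lt \<subseteq> X \<times> X"
  shows "num_lin_exts (X, lt) > 0"
  using assms
proof (induction X arbitrary: lt rule: finite_psubset_induct)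
  case (psubset X)
  show ?case
  proof (cases "X = {}")
    case True
    then have "lin_exts (X, lt) = {\<lambda>_. undefined}"
      using psubset.prems(3) by (auto simp: lin_exts_def bij_betw_def)
    then show ?thesis by (simp add: num_lin_exts_def)
  next
    case False
    have "wf (lt\<inverse>)"
      using psubset.prems psubset.hyps finite_subset[of lt "X \<times> X"]
      by (intro finite_acyclic_wf_converse) (auto simp: acyclic_irrefl trancl_id)
    then obtain t where t: "t \<in> X" "\<And>a. (t, a) \<in> lt \<Longrightarrow> a \<notin> X"
      using False wfE_min[of "lt\<inverse>" _ X] by (metis converse_iff ex_in_conv)
    let ?A = "X - {t}"
    have X: "?A \<union> {t} = X" using t(1) by auto
    have "lt \<inter> {t} \<times> {t} = {}" using psubset.prems(1) by (auto simp: irrefl_def)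
    then have "card {f \<in> lin_exts (X, lt). f ` ?A = {1..card ?A}} = num_lin_exts (?A, lt \<inter> ?A \<times> ?A)"
      using card_lin_exts_split[of ?A "{t}" lt] psubset.prems psubset.hyps t X
      by (auto simp: num_lin_exts_singleton)
    moreover have "num_lin_exts (?A, lt \<inter> ?A \<times> ?A) > 0"
      using psubset.prems t(1)
      by (intro psubset.IH) (auto simp: irrefl_def intro!: transI dest: transD)
    moreover have "card {f \<in> lin_exts (X, lt). f ` ?A = {1..card ?A}} \<le> num_lin_exts (X, lt)"
      unfolding num_lin_exts_def using finite_lin_exts[OF psubset.hyps] by (intro card_mono) auto
    ultimately show ?thesis by linarith
  qed
qed


section \<open>The glued poset\<close>

text \<open>
  Labels below \<open>n\<close> are the elements of \<open>P\<close>, label \<open>n + b\<close> is the element \<open>b\<close> of \<open>Q\<close>. The label \<open>x\<close> is used for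
  the element \<open>s\<close> that merges \<open>x\<close> and \<open>y\<close>; this frees the label \<open>n + y\<close> for \<open>w\<close>.
\<close>

definition glued_less :: "nat \<Rightarrow> (nat \<times> nat) set \<Rightarrow> (nat \<times> nat) set \<Rightarrow> nat \<Rightarrow> nat \<Rightarrow> nat \<Rightarrow> nat \<Rightarrow> bool" where
  "glued_less n ltP ltQ x y a b =
     (if a < n then if b < n then (b, a) \<in> ltP else if a = x then (y, b - n) \<in> ltQ else True
      else if b < n then False else if a - n = y then b - n \<noteq> y else (a - n, b - n) \<in> ltQ)"

definition glued_rel :: "nat \<Rightarrow> nat \<Rightarrow> (nat \<times> nat) set \<Rightarrow> (nat \<times> nat) set \<Rightarrow> nat \<Rightarrow> nat \<Rightarrow> (nat \<times> nat) set" where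
  "glued_rel n m ltP ltQ x y = {(a, b). a < n + m \<and> b < n + m \<and> glued_less n ltP ltQ x y a b}"

context
  fixes n m x y :: nat and ltP ltQ :: "(nat \<times> nat) set"
  assumes P: "finite_poset ({..<n}, ltP)" and Q: "finite_poset ({..<m}, ltQ)"
    and x: "x \<in> min_elems ({..<n}, ltP)" and y: "y \<in> min_elems ({..<m}, ltQ)"
begin

private abbreviation (input) "R \<equiv> glued_rel n m ltP ltQ x y"
private abbreviation (input) "w \<equiv> n + y"
private abbreviation (input) "L \<equiv> {..<n} - {x}"
private abbreviation (input) "U \<equiv> {n..<n + m} - {w}"

private lemma props:
  "ltP \<subseteq> {..<n} \<times> {..<n}" "ltQ \<subseteq> {..<m} \<times> {..<m}" "irrefl ltP" "irrefl ltQ" "trans ltP" "trans ltQ"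
  "x < n" "y < m" "(u, x) \<notin> ltP" "(u, y) \<notin> ltQ"
  using P Q x y by (auto simp: finite_poset_def min_elems_def)

private lemma R_sub: "R \<subseteq> {..<n + m} \<times> {..<n + m}"
  unfolding glued_rel_def by auto

text \<open>One rule per pair of blocks, so that simplification decides a relation once the blocks
  of both labels are known. The pair \<open>(x, w)\<close> reduces to
  \<open>(y, y) \<in> ltQ\<close>, which is false: this is the incomparability of the merged element
  and \<open>w\<close>.\<close>

private lemma R_iff [simp]:
  "a < n \<Longrightarrow> b < n \<Longrightarrow> (a, b) \<in> R \<longleftrightarrow> (b, a) \<in> ltP"
  "n \<le> b \<Longrightarrow> b < n + m \<Longrightarrow> (x, b) \<in> R \<longleftrightarrow> (y, b - n) \<in> ltQ"
  "a < n \<Longrightarrow> a \<noteq> x \<Longrightarrow> n \<le> b \<Longrightarrow> b < n + m \<Longrightarrow> (a, b) \<in> R"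
  "n \<le> a \<Longrightarrow> b < n \<Longrightarrow> (a, b) \<notin> R"
  "n \<le> b \<Longrightarrow> b < n + m \<Longrightarrow> (w, b) \<in> R \<longleftrightarrow> b \<noteq> w"
  "n \<le> a \<Longrightarrow> a < n + m \<Longrightarrow> a \<noteq> w \<Longrightarrow> n \<le> b \<Longrightarrow> b < n + m \<Longrightarrow>
    (a, b) \<in> R \<longleftrightarrow> (a - n, b - n) \<in> ltQ"
  using props(7,8) by (auto simp: glued_rel_def glued_less_def)

private lemma elem_cases:
  assumes "a < n + m"
  obtains "a \<in> L" | "a = x" | "a \<in> U" | "a = w"
  using assms by fastforce

lemma finite_poset_glued: "finite_poset ({..<n + m}, R)"
proof -
  have "irrefl R"
    unfolding irrefl_def
  proof
    fix a
    show "(a, a) \<notin> R"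
    proof (cases "a < n + m")
      case True
      then show ?thesis
        using props(3,4,7,8) by (cases rule: elem_cases) (auto simp: irrefl_def)
    qed (use R_sub in auto)
  qed
  moreover have "trans R"
  proof (rule transI)
    fix a b c assume ab: "(a, b) \<in> R" and bc: "(b, c) \<in> R"
    have lt: "a < n + m" "b < n + m" "c < n + m" using ab bc R_sub by auto
    note [simp] = props(7-10)
    show "(a, c) \<in> R"
    \<comment> \<open>Chains from \<open>L\<close> through \<open>x\<close> into \<open>U\<close>
      close because \<open>L\<close> lies below the whole upper part. A chain from \<open>x\<close>
      through \<open>L\<close> to \<open>w\<close>, which would break transitivity, cannot occur:
      minimality of \<open>x\<close> in \<open>P\<close> puts nothing of \<open>L\<close> above
      \<open>x\<close> in the dual.\<close>
    proof (cases rule: elem_cases[OF lt(1)]; cases rule: elem_cases[OF lt(2)];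
        cases rule: elem_cases[OF lt(3)])
    qed (use ab bc in \<open>auto dest: transD[OF props(5)] transD[OF props(6)]\<close>)
  qed
  ultimately show ?thesis
    using R_sub by (simp add: finite_poset_def)
qed

private lemma le_memD:
  assumes "f \<in> lin_exts ({..<n + m}, R)"
  shows "bij_betw f {..<n + m} {1..n + m}" "\<And>a b. (a, b) \<in> R \<Longrightarrow> f a < f b"
  using lin_exts_memD[OF assms] by auto

private lemma num_lower: "num_lin_exts (L, R \<inter> L \<times> L) = num_lin_exts (delete_elem ({..<n}, ltP) x)"
proof -
  have "R \<inter> L \<times> L = (ltP \<inter> L \<times> L)\<inverse>" by auto
  then show ?thesis by (simp add: num_lin_exts_converse delete_elem_def)
qed

private lemma num_lower_glued: "num_lin_exts ({..<n}, R \<inter> {..<n} \<times> {..<n}) = num_lin_exts ({..<n}, ltP)"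
proof -
  have "R \<inter> {..<n} \<times> {..<n} = ltP\<inverse>" using props(1) by auto
  then show ?thesis using props(1) by (simp add: num_lin_exts_converse)
qed

private lemma num_upper: "num_lin_exts (U, R \<inter> U \<times> U) = num_lin_exts (delete_elem ({..<m}, ltQ) y)"
  unfolding delete_elem_def prod.case
proof (rule num_lin_exts_iso[where \<phi> = "(+) n"])
  show "bij_betw ((+) n) ({..<m} - {y}) U"
    by (rule bij_betw_byWitness[where f' = "\<lambda>b. b - n"]) auto
qed auto

private lemma num_upper_glued:
  "num_lin_exts (insert x U, R \<inter> insert x U \<times> insert x U) = num_lin_exts ({..<m}, ltQ)"
proof (rule num_lin_exts_iso[where \<phi> = "\<lambda>b. if b = y then x else n + b"])
  show "bij_betw (\<lambda>b. if b = y then x else n + b) {..<m} (insert x U)"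
    using props(7,8)
    by (intro bij_betw_byWitness[where f' = "\<lambda>b. if b = x then y else b - n"]) auto
qed (use props in \<open>auto simp: irrefl_def\<close>)

text \<open>\<open>w\<close> lies above the \<open>n - 1\<close> elements of \<open>L\<close>, so it
  has position \<open>n\<close> exactly when \<open>insert w L\<close> fills the first
  \<open>n\<close> positions. This trades a position for an initial segment, as
  \<open>card_lin_exts_split\<close> requires; the rest, \<open>insert x U\<close>, is a copy of
  \<open>Q\<close> in which \<open>x\<close> stands for \<open>y\<close>.\<close>

lemma num_lin_exts_at_glued:
  "num_lin_exts_at ({..<n + m}, R) w n =
     num_lin_exts (delete_elem ({..<n}, ltP) x) * num_lin_exts ({..<m}, ltQ)"
proof -
  let ?A = "insert w L" and ?B = "insert x U"
  have AB: "?A \<union> ?B = {..<n + m}" "?A \<inter> ?B = {}" and cardL: "card L = n - 1" and cardA: "card ?A = n"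
    using props(7,8) by auto
  have "f w = n \<longleftrightarrow> f ` ?A = {1..card ?A}" if f: "f \<in> lin_exts ({..<n + m}, R)" for f
  proof
    have below: "f a < f w" if "a \<in> L" for a
      using that props(8) by (intro le_memD(2)[OF f]) auto
    have inj: "inj_on f {..<n + m}" using le_memD(1)[OF f] by (simp add: bij_betw_def)
    have pos: "f a \<ge> 1" if "a < n + m" for a
      using that bij_betwE[OF le_memD(1)[OF f]] by auto
    show "f ` ?A = {1..card ?A}" if w: "f w = n"
    proof (rule card_subset_eq)
      show "f ` ?A \<subseteq> {1..card ?A}"
      proof
        fix i assume "i \<in> f ` ?A"
        then obtain a where a: "a \<in> ?A" "i = f a" by blast
        moreover have "f a \<le> n" using a(1) below[of a] w by (metis insertE less_imp_le order_refl)
        moreover have "a < n + m" using a(1) props(8) by auto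
        ultimately show "i \<in> {1..card ?A}" using pos unfolding cardA by simp
      qed
      show "card (f ` ?A) = card {1..card ?A}"
        using card_image[OF inj_on_subset[OF inj, of ?A]] AB(1) by (metis Un_upper1 card_atLeastAtMost diff_Suc_1)
    qed simp
    \<comment> \<open>Some element of \<open>?A\<close> takes position \<open>n\<close>; were it in
      \<open>L\<close>, then \<open>w\<close>, which comes later, would leave the segment.\<close>
    show "f w = n" if A: "f ` ?A = {1..card ?A}"
    proof -
      have "n \<in> f ` ?A" unfolding A cardA using props(7) by simp
      then obtain a where "a \<in> ?A" "f a = n" by blast
      moreover have "f w \<le> n" using A unfolding cardA by auto
      ultimately show ?thesis using below by force
    qed
  qed
  then have "num_lin_exts_at ({..<n + m}, R) w n =
      card {f \<in> lin_exts (?A \<union> ?B, R). f ` ?A = {1..card ?A}}"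
    unfolding num_lin_exts_at_def AB(1) by (metis (no_types, lifting))
  also have "\<dots> = num_lin_exts (?A, R \<inter> ?A \<times> ?A) * num_lin_exts (?B, R \<inter> ?B \<times> ?B)"
  proof (rule card_lin_exts_split)
    show "R \<subseteq> (?A \<union> ?B) \<times> (?A \<union> ?B)" unfolding AB(1) by (rule R_sub)
    \<comment> \<open>For \<open>b = x\<close>, minimality of \<open>x\<close> settles
      \<open>L\<close> and irreflexivity of \<open>ltQ\<close> settles \<open>w\<close>; for
      \<open>b\<close> in \<open>U\<close> against \<open>w\<close> it is minimality of
      \<open>y\<close>.\<close>
    show "(b, a) \<notin> R" if "a \<in> ?A" "b \<in> ?B" for a b
      using that props by (auto simp: irrefl_def)
  qed (use AB(2) in auto)
  also have "num_lin_exts (?A, R \<inter> ?A \<times> ?A) = num_lin_exts (L, R \<inter> L \<times> L)"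
  proof -
    have "num_lin_exts (?A, R \<inter> ?A \<times> ?A) = num_lin_exts (L, R \<inter> ?A \<times> ?A \<inter> L \<times> L)"
      using props(8) by (intro num_lin_exts_top) auto
    also have "R \<inter> ?A \<times> ?A \<inter> L \<times> L = R \<inter> L \<times> L" by auto
    finally show ?thesis .
  qed
  finally show ?thesis unfolding num_lower num_upper_glued .
qed

text \<open>The same seen from above: \<open>w\<close> lies below all of \<open>U\<close>, so at
  position \<open>n + 1\<close> it leaves only the labels below \<open>n\<close> for the first
  \<open>n\<close> positions. These now include \<open>x\<close> and form the dual of
  \<open>P\<close>.\<close>

lemma num_lin_exts_at_Suc_glued:
  "num_lin_exts_at ({..<n + m}, R) w (n + 1) =
     num_lin_exts ({..<n}, ltP) * num_lin_exts (delete_elem ({..<m}, ltQ) y)"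
proof -
  let ?A = "{..<n}" and ?B = "insert w U"
  have AB: "?A \<union> ?B = {..<n + m}" "?A \<inter> ?B = {}"
    using props(7,8) by auto
  have "f w = n + 1 \<longleftrightarrow> f ` ?A = {1..card ?A}" if f: "f \<in> lin_exts ({..<n + m}, R)" for f
  proof
    have above: "f w < f b" if "b \<in> U" for b
      using that props(8) by (intro le_memD(2)[OF f]) auto
    have bij: "bij_betw f (?A \<union> ?B) {1..n + m}" unfolding AB(1) by (rule le_memD(1)[OF f])
    have inj: "inj_on f ?A" using bij by (auto simp: bij_betw_def inj_on_def)
    show "f ` ?A = {1..card ?A}" if w: "f w = n + 1"
    proof (rule sym, rule card_subset_eq)
      show "{1..card ?A} \<subseteq> f ` ?A"
      proof
        fix i assume i: "i \<in> {1..card ?A}"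
        then have "i \<in> f ` (?A \<union> ?B)" using bij by (simp add: bij_betw_def)
        then obtain c where c: "c \<in> ?A \<union> ?B" "i = f c" by blast
        moreover have "c \<notin> ?B" using c(2) i w above[of c] by (metis atLeastAtMost_iff card_lessThan insertE
            less_Suc_eq_le not_less Suc_eq_plus1 le_SucI)
        ultimately show "i \<in> f ` ?A" by blast
      qed
      show "card {1..card ?A} = card (f ` ?A)" using inj by (simp add: card_image)
    qed simp
    show "f w = n + 1" if A: "f ` ?A = {1..card ?A}"
    proof -
      have B: "f ` ?B = {n + 1..n + m}"
        using bij_betw_remaining[OF bij AB(2) A] by simp
      have "n + 1 \<in> f ` ?B" unfolding B using props(8) by simp
      then obtain b where "b \<in> ?B" "f b = n + 1" by (metis imageE)
      moreover have "f w \<in> {n + 1..n + m}" using B by blast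
      ultimately show ?thesis using above by force
    qed
  qed
  then have "num_lin_exts_at ({..<n + m}, R) w (n + 1) =
      card {f \<in> lin_exts (?A \<union> ?B, R). f ` ?A = {1..card ?A}}"
    unfolding num_lin_exts_at_def AB(1) by (metis (no_types, lifting))
  also have "\<dots> = num_lin_exts (?A, R \<inter> ?A \<times> ?A) * num_lin_exts (?B, R \<inter> ?B \<times> ?B)"
  proof (rule card_lin_exts_split)
    show "R \<subseteq> (?A \<union> ?B) \<times> (?A \<union> ?B)" unfolding AB(1) by (rule R_sub)
    show "(b, a) \<notin> R" if "a \<in> ?A" "b \<in> ?B" for a b
      using that by auto
  qed (use AB(2) in auto)
  also have "num_lin_exts (?B, R \<inter> ?B \<times> ?B) = num_lin_exts (U, R \<inter> U \<times> U)"
  proof -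
    have "(a, w) \<notin> R" if "a \<in> ?B" for a
      using that props(8,10) by (cases "a = w") auto
    then have "num_lin_exts (?B, R \<inter> ?B \<times> ?B) = num_lin_exts (U, R \<inter> ?B \<times> ?B \<inter> U \<times> U)"
      using props(8,10) by (intro num_lin_exts_bot) auto
    also have "R \<inter> ?B \<times> ?B \<inter> U \<times> U = R \<inter> U \<times> U" by auto
    finally show ?thesis .
  qed
  finally show ?thesis unfolding num_lower_glued num_upper .
qed

lemma rho_eq_iff_glued:
  "num_lin_exts_at ({..<n + m}, R) w n = num_lin_exts_at ({..<n + m}, R) w (n + 1) \<longleftrightarrow>
     rho ({..<n}, ltP) x = rho ({..<m}, ltQ) y"
proof -
  \<comment> \<open>Division by zero gives zero, so equal quotients amount to equal cross products
    only once both denominators are known to be positive.\<close>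
  have "num_lin_exts (delete_elem ({..<k}, lt) z) > 0" if "finite_poset ({..<k}, lt)" for k z :: nat and lt
    unfolding delete_elem_def prod.case using that
    by (intro num_lin_exts_pos) (auto simp: finite_poset_def irrefl_def intro!: transI dest: transD)
  from this[OF P, of x] this[OF Q, of y] show ?thesis
    unfolding num_lin_exts_at_glued num_lin_exts_at_Suc_glued rho_def
    by (simp add: frac_eq_eq flip: of_nat_mult) (metis mult.commute)
qed

end


section \<open>Structured programs for Turing machines\<close>

text \<open>An action sees the scanned symbols as a function of the tape index and acts on all tapes
  at once; total functions keep the program text independent of the number \<open>K\<close> of
  tapes.\<close>

datatype prog =
    Act "(nat \<Rightarrow> nat) \<Rightarrow> nat \<Rightarrow> nat \<times> head_move"
  | Seq prog prog (infixr ";;" 60)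
  | While "(nat \<Rightarrow> nat) \<Rightarrow> bool" prog

text \<open>The number of non-halting states, hence also the index of the halting state; the extra
  state of a loop performs its test.\<close>

fun prog_size :: "prog \<Rightarrow> nat" where
  "prog_size (Act g) = 1"
| "prog_size (p ;; q) = prog_size p + prog_size q"
| "prog_size (While b p) = Suc (prog_size p)"

fun wf_prog :: "prog \<Rightarrow> bool" where
  "wf_prog (Act g) \<longleftrightarrow> (\<forall>r. (\<forall>k. r k < 4) \<longrightarrow> (\<forall>k. fst (g r k) < 4))"
| "wf_prog (p ;; q) \<longleftrightarrow> wf_prog p \<and> wf_prog q"
| "wf_prog (While b p) \<longleftrightarrow> wf_prog p"

text \<open>A worst case in which every loop makes \<open>B\<close> iterations, each one test plus
  the body; the final 1 is the failing test.\<close>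

fun cost :: "prog \<Rightarrow> nat \<Rightarrow> nat" where
  "cost (Act g) B = 1"
| "cost (p ;; q) B = cost p B + cost q B"
| "cost (While b p) B = B * Suc (cost p B) + 1"

lemma cost_polynomial: "\<exists>c d. \<forall>B. cost p B \<le> c * B ^ d + c"
proof (induction p)
  case (Act g)
  have "\<forall>B. cost (Act g) B \<le> 1 * B ^ 0 + 1" by simp
  then show ?case by blast
next
  case (Seq p q)
  then obtain c d c' d' where p: "\<And>B. cost p B \<le> c * B ^ d + c"
    and q: "\<And>B. cost q B \<le> c' * B ^ d' + c'" by blast
  \<comment> \<open>This brings both bounds to the exponent \<open>d + d'\<close>. The summand 1
    covers \<open>B = 0\<close>, where \<open>0 ^ 0 = 1\<close>.\<close>
  have pow: "B ^ i \<le> B ^ (i + j) + 1" for B i j :: nat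
    by (cases "B = 0") (auto simp: power_add power_0_left intro: le_SucI)
  have "cost (p ;; q) B \<le> (2 * c + 2 * c') * B ^ (d + d') + (2 * c + 2 * c')" for B
    using p[of B] q[of B] mult_left_mono[OF pow[of B d d'], of c] mult_left_mono[OF pow[of B d' d], of c']
    by (simp add: algebra_simps)
  then show ?case by blast
next
  case (While b p)
  then obtain c d where p: "\<And>B. cost p B \<le> c * B ^ d + c" by blast
  have pow: "B \<le> B ^ Suc d" for B :: nat
    by (cases "B = 0") auto
  have "cost (While b p) B \<le> (2 * c + 1) * B ^ Suc d + (2 * c + 1)" for B
    using mult_left_mono[OF p[of B], of B] mult_left_mono[OF pow[of B], of "Suc c"]
    by (simp add: algebra_simps)
  then show ?case by blast
qed

section \<open>Compilation of programs into machines, with exact step counts\<close>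

context
  fixes K :: nat
begin

text \<open>Beyond the \<open>K\<close> existing tapes, programs see a blank whatever \<open>\<sigma>\<close> contains there.\<close>

definition scan :: "(nat \<Rightarrow> tape) \<Rightarrow> nat \<Rightarrow> nat" where
  "scan \<sigma> k = (if k < K then case \<sigma> k of (t, i) \<Rightarrow> t i else 0)"

definition scanned :: "nat list \<Rightarrow> nat \<Rightarrow> nat" where
  "scanned ss k = (if k < K then ss ! k else 0)"

text \<open>Shifting \<open>p2\<close> by \<open>prog_size p1\<close> makes the halting state of
  \<open>p1\<close> the start of \<open>p2\<close>. In a loop, state 0 tests and leaves the tapes
  alone, body states move up by one, and the halting state of the body leads back to 0.\<close>

fun prog_delta :: "prog \<Rightarrow> nat \<Rightarrow> nat list \<Rightarrow> nat \<times> (nat \<times> head_move) list" where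
  "prog_delta (Act g) q ss = (1, map (g (scanned ss)) [0..<K])"
| "prog_delta (p1 ;; p2) q ss =
     (if q < prog_size p1 then prog_delta p1 q ss
      else apfst ((+) (prog_size p1)) (prog_delta p2 (q - prog_size p1) ss))"
| "prog_delta (While b p) q ss =
     (if q = 0 then (if b (scanned ss) then 1 else Suc (prog_size p), map (\<lambda>s. (s, Stay)) ss)
      else apfst (\<lambda>r. if r = prog_size p then 0 else Suc r) (prog_delta p (q - 1) ss))"

definition prog_tm :: "prog \<Rightarrow> turing_machine" where
  "prog_tm p = \<lparr>tm_tapes = K, tm_syms = 4, tm_states = prog_size p, tm_delta = prog_delta p\<rparr>"

text \<open>The number is the exact count of machine steps: sequencing is free because the two parts
  share a state, and a test costs one step.\<close>

inductive exec :: "prog \<Rightarrow> (nat \<Rightarrow> tape) \<Rightarrow> nat \<Rightarrow> (nat \<Rightarrow> tape) \<Rightarrow> bool" where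
  exec_Act: "exec (Act g) \<sigma> 1 (\<lambda>k. if k < K then tape_act (g (scan \<sigma>) k) (\<sigma> k) else \<sigma> k)"
| exec_Seq: "exec p \<sigma> t \<sigma>' \<Longrightarrow> exec q \<sigma>' t' \<sigma>'' \<Longrightarrow> exec (p ;; q) \<sigma> (t + t') \<sigma>''"
| exec_While_False: "\<not> b (scan \<sigma>) \<Longrightarrow> exec (While b p) \<sigma> 1 \<sigma>"
| exec_While_True: "b (scan \<sigma>) \<Longrightarrow> exec p \<sigma> t \<sigma>' \<Longrightarrow> exec (While b p) \<sigma>' t' \<sigma>'' \<Longrightarrow>
    exec (While b p) \<sigma> (Suc (t + t')) \<sigma>''"

text \<open>Every step departs from a state below \<open>N\<close>, so no trace continues past
  halting. Using a bare transition function instead of a machine lets the trace of a subprogram be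
  relabelled inside a larger program.\<close>

inductive trace :: "(nat \<Rightarrow> nat list \<Rightarrow> nat \<times> (nat \<times> head_move) list) \<Rightarrow> nat \<Rightarrow>
    config \<Rightarrow> nat \<Rightarrow> config \<Rightarrow> bool" for d N where
  trace_refl: "trace d N c 0 c"
| trace_step: "q < N \<Longrightarrow> d q (map (\<lambda>(t, i). t i) ts) = (q', as) \<Longrightarrow>
    trace d N (q', map2 tape_act as ts) t c \<Longrightarrow> trace d N (q, ts) (Suc t) c"

lemma trace_trans: "trace d N c t c' \<Longrightarrow> trace d N c' t' c'' \<Longrightarrow> trace d N c (t + t') c''"
  by (induction rule: trace.induct) (auto intro: trace_step)

text \<open>Used with the three state maps of the compiler: the identity, the shift for the second
  part of a sequence, and the redirection for a loop body.\<close>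

lemma trace_embed:
  assumes "trace d N c t c'"
    and "\<And>q ss. q < N \<Longrightarrow> f q < N' \<and> d' (f q) ss = apfst f (d q ss)"
  shows "trace d' N' (apfst f c) t (apfst f c')"
  using assms(1)
proof (induction rule: trace.induct)
  case (trace_step q ts q' as t c)
  then show ?case
    using assms(2)[OF trace_step.hyps(1)] by (auto intro!: trace.trace_step)
qed (rule trace_refl)

lemma trace_imp_tm_step:
  "trace (tm_delta M) (tm_states M) c t c' \<Longrightarrow> (tm_step M ^^ t) c = c'"
  by (induction rule: trace.induct) (auto simp: funpow_swap1 simp del: funpow.simps(2) simp: funpow_Suc_right)

definition tapes :: "(nat \<Rightarrow> tape) \<Rightarrow> tape list" where
  "tapes \<sigma> = map \<sigma> [0..<K]"

lemma scanned_tapes: "scanned (map (\<lambda>(t, i). t i) (tapes \<sigma>)) = scan \<sigma>"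
  by (auto simp: scanned_def scan_def tapes_def fun_eq_iff)

lemma tapes_stay: "map2 tape_act (map (\<lambda>s. (s, Stay)) (map (\<lambda>(t, i). t i) (tapes \<sigma>))) (tapes \<sigma>) = tapes \<sigma>"
  by (rule nth_equalityI) (auto simp: tapes_def split: prod.split)

lemma exec_imp_trace:
  "exec p \<sigma> t \<sigma>' \<Longrightarrow> trace (prog_delta p) (prog_size p) (0, tapes \<sigma>) t (prog_size p, tapes \<sigma>')"
proof (induction rule: exec.induct)
  case (exec_Act g \<sigma>)
  have "map2 tape_act (map (g (scan \<sigma>)) [0..<K]) (tapes \<sigma>) = 
      tapes (\<lambda>k. if k < K then tape_act (g (scan \<sigma>) k) (\<sigma> k) else \<sigma> k)"
    by (rule nth_equalityI) (auto simp: tapes_def)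
  then have "trace (prog_delta (Act g)) 1 (0, tapes \<sigma>) (Suc 0)
      (1, tapes (\<lambda>k. if k < K then tape_act (g (scan \<sigma>) k) (\<sigma> k) else \<sigma> k))"
    by (intro trace_step[of _ _ _ _ 1 "map (g (scan \<sigma>)) [0..<K]"]) (simp_all add: scanned_tapes trace_refl)
  then show ?case by (simp del: prog_delta.simps(1))
next
  case (exec_Seq p \<sigma> t \<sigma>' q t' \<sigma>'')
  have "trace (prog_delta (p ;; q)) (prog_size (p ;; q)) (0, tapes \<sigma>) t (prog_size p, tapes \<sigma>')"
    using trace_embed[OF exec_Seq.IH(1), of id "prog_size (p ;; q)" "prog_delta (p ;; q)"] by simp
  moreover have "trace (prog_delta (p ;; q)) (prog_size (p ;; q))
      (prog_size p, tapes \<sigma>') t' (prog_size (p ;; q), tapes \<sigma>'')"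
    using trace_embed[OF exec_Seq.IH(2), of "(+) (prog_size p)" "prog_size (p ;; q)" "prog_delta (p ;; q)"]
    by simp
  ultimately show ?case by (rule trace_trans)
next
  case (exec_While_False b \<sigma> p)
  then show ?case
    unfolding One_nat_def
    by (intro trace_step[of _ _ _ _ "prog_size (While b p)"
          "map (\<lambda>s. (s, Stay)) (map (\<lambda>(t, i). t i) (tapes \<sigma>))"])
      (simp_all add: scanned_tapes tapes_stay trace_refl del: map_map)
next
  case (exec_While_True b \<sigma> p t \<sigma>' t' \<sigma>'')
  let ?f = "\<lambda>r. if r = prog_size p then 0 else Suc r"
  \<comment> \<open>In a body of size 0 the start would be the halting state, and the redirection
    would send it to the test instead of to state 1.\<close>
  have pos: "prog_size p > 0" for p by (induction p) auto
  have "trace (prog_delta (While b p)) (prog_size (While b p)) (1, tapes \<sigma>) t (0, tapes \<sigma>')"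
    using trace_embed[OF exec_While_True.IH(1), of ?f "prog_size (While b p)" "prog_delta (While b p)"]
      pos[of p] by simp
  from trace_trans[OF this exec_While_True.IH(2)]
  have tr: "trace (prog_delta (While b p)) (prog_size (While b p))
      (1, map2 tape_act (map (\<lambda>s. (s, Stay)) (map (\<lambda>(t, i). t i) (tapes \<sigma>))) (tapes \<sigma>))
      (t + t') (prog_size (While b p), tapes \<sigma>'')"
    unfolding tapes_stay .
  have d: "prog_delta (While b p) 0 (map (\<lambda>(t, i). t i) (tapes \<sigma>)) =
      (1, map (\<lambda>s. (s, Stay)) (map (\<lambda>(t, i). t i) (tapes \<sigma>)))"
    using exec_While_True.hyps(1) by (simp add: scanned_tapes)
  show ?case
    by (rule trace_step[OF _ d tr]) simp
qed

lemma prog_delta_wf: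
  assumes "wf_prog p" "q < prog_size p" "length ss = K" "set ss \<subseteq> {..<4}"
  shows "fst (prog_delta p q ss) \<le> prog_size p" "length (snd (prog_delta p q ss)) = K"
    "fst ` set (snd (prog_delta p q ss)) \<subseteq> {..<4}"
proof -
  have "\<forall>k. scanned ss k < 4"
    using assms(3,4) nth_mem[of _ ss] by (auto simp: scanned_def subset_iff)
  with assms(1,2) have "fst (prog_delta p q ss) \<le> prog_size p \<and> length (snd (prog_delta p q ss)) = K \<and>
    fst ` set (snd (prog_delta p q ss)) \<subseteq> {..<4}"
  proof (induction p arbitrary: q)
    case (Seq p1 p2)
    from Seq.IH(1)[of q] Seq.IH(2)[of "q - prog_size p1"] Seq.prems show ?case
      by auto
  next
    case (While b p)
    from While.IH[of "q - 1"] While.prems show ?case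
      using assms(3,4) by auto
  qed auto
  then show "fst (prog_delta p q ss) \<le> prog_size p" "length (snd (prog_delta p q ss)) = K"
    "fst ` set (snd (prog_delta p q ss)) \<subseteq> {..<4}" by auto
qed

lemma wf_prog_tm:
  assumes "wf_prog p" "K \<ge> 1"
  shows "wf_tm (prog_tm p)"
  using assms prog_delta_wf[OF assms(1)] unfolding wf_tm_def prog_tm_def
  by (fastforce split: prod.split)

lemma prog_tm_outputs_within:
  assumes "exec p (\<lambda>k. (tape_content (if k = 0 then w else []), 0)) t \<sigma>" "t \<le> T"
    and "K \<ge> 1" "fst (\<sigma> (K - 1)) = tape_content v"
  shows "tm_outputs_within (prog_tm p) w v T"
proof -
  have "start_config (prog_tm p) w = (0, tapes (\<lambda>k. (tape_content (if k = 0 then w else []), 0)))"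
    using assms(3)
    by (auto simp: start_config_def prog_tm_def tapes_def list_eq_iff_nth_eq nth_Cons')
  moreover have "last (tapes \<sigma>) = \<sigma> (K - 1)"
    using assms(3) by (simp add: tapes_def last_map)
  ultimately show ?thesis
    using trace_imp_tm_step[of "prog_tm p"] exec_imp_trace[OF assms(1)] assms(2,4)
    unfolding tm_outputs_within_def
    by (auto intro!: exI[of _ t] simp: prog_tm_def)
qed

section \<open>Runs in which every loop makes at most \<open>B\<close> iterations\<close>

context
  fixes B :: nat
begin

text \<open>The bound \<open>cost p B\<close> is what makes the rule for loops require at most \<open>B\<close> iterations.\<close>

definition runs :: "prog \<Rightarrow> (nat \<Rightarrow> tape) \<Rightarrow> (nat \<Rightarrow> tape) \<Rightarrow> bool" where
  "runs p \<sigma> \<sigma>' \<longleftrightarrow> (\<exists>t \<le> cost p B. exec p \<sigma> t \<sigma>')"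

lemma runs_Act:
  "runs (Act g) \<sigma> (\<lambda>k. if k < K then tape_act (g (scan \<sigma>) k) (\<sigma> k) else \<sigma> k)"
  using exec_Act[of g \<sigma>] by (auto simp: runs_def)

lemma runs_Seq: "runs p \<sigma> \<sigma>' \<Longrightarrow> runs q \<sigma>' \<sigma>'' \<Longrightarrow> runs (p ;; q) \<sigma> \<sigma>''"
  unfolding runs_def cost.simps by (meson add_mono exec_Seq)

lemma runs_While:
  assumes "N \<le> B" "\<And>i. i < N \<Longrightarrow> b (scan (S i))" "\<And>i. i < N \<Longrightarrow> runs p (S i) (S (Suc i))"
    and "\<not> b (scan (S N))"
  shows "runs (While b p) (S 0) (S N)"
proof -
  \<comment> \<open>Induction on the number \<open>j\<close> of iterations still to come, because
    \<open>exec_While_True\<close> puts an iteration in front of a finished loop.\<close>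
  have "\<exists>t \<le> j * Suc (cost p B) + 1. exec (While b p) (S (N - j)) t (S N)" if "j \<le> N" for j
    using that
  proof (induction j)
    case 0
    then show ?case using exec_While_False[of b "S N" p] assms(4) by auto
  next
    case (Suc j)
    then obtain t' where t': "t' \<le> j * Suc (cost p B) + 1" "exec (While b p) (S (N - j)) t' (S N)"
      by auto
    have less: "N - Suc j < N" and eq: "Suc (N - Suc j) = N - j" using Suc.prems by auto
    obtain t where t: "t \<le> cost p B" "exec p (S (N - Suc j)) t (S (N - j))"
      using assms(3)[OF less] unfolding runs_def eq by blast
    have "exec (While b p) (S (N - Suc j)) (Suc (t + t')) (S N)"
      using assms(2)[OF less] t(2) t'(2) by (rule exec_While_True)
    moreover have "Suc (t + t') \<le> Suc j * Suc (cost p B) + 1"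
      using t(1) t'(1) by simp
    ultimately show ?case by blast
  qed
  from this[of N] obtain t where t: "t \<le> N * Suc (cost p B) + 1" "exec (While b p) (S 0) t (S N)"
    by auto
  moreover have "N * Suc (cost p B) + 1 \<le> cost (While b p) B"
    using mult_right_mono[OF assms(1), of "Suc (cost p B)"] by simp
  ultimately show ?thesis unfolding runs_def by (meson order_trans)
qed

end

end

section \<open>Tape idioms: appending, rewinding and counted loops\<close>

definition emit :: "nat set \<Rightarrow> ((nat \<Rightarrow> nat) \<Rightarrow> nat) \<Rightarrow> nat set \<Rightarrow> prog" where
  "emit W f R = Act (\<lambda>r k. if k \<in> W then (f r, Go_Right) else (r k, if k \<in> R then Go_Right else Stay))"

abbreviation advance :: "nat set \<Rightarrow> prog" where
  "advance R \<equiv> emit {} (\<lambda>_. 0) R"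

definition retreat :: "nat \<Rightarrow> prog" where
  "retreat j = Act (\<lambda>r k. (r k, if k = j then Go_Left else Stay))"

text \<open>Only cell 0 holds the symbol 1, so the left end is found without a counter; the last
  step puts the head on cell 1, where the data begin.\<close>

definition rewind :: "nat \<Rightarrow> prog" where
  "rewind k = While (\<lambda>r. r k \<noteq> 1) (retreat k) ;; advance {k}"

definition loop :: "nat \<Rightarrow> prog \<Rightarrow> prog" where
  "loop k p = While (\<lambda>r. r k = 3) (p ;; advance {k}) ;; rewind k"

lemma wf_emit:
  assumes "\<And>r. (\<And>k. r k < 4) \<Longrightarrow> f r < 4"
  shows "wf_prog (emit W f R)"
  using assms by (simp add: emit_def)

lemma wf_retreat [simp]: "wf_prog (retreat k)"
  by (simp add: retreat_def)

lemma wf_rewind [simp]: "wf_prog (rewind k)"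
  by (simp add: rewind_def wf_emit)

lemma wf_loop [simp]: "wf_prog (loop k p) \<longleftrightarrow> wf_prog p"
  by (simp add: loop_def wf_emit)

definition tape_at :: "bool list \<Rightarrow> nat \<Rightarrow> tape" where
  "tape_at v h = (tape_content v, h)"

text \<open>The head is on the first blank behind \<open>v\<close>, ready to append.\<close>

abbreviation full :: "bool list \<Rightarrow> tape" where
  "full v \<equiv> tape_at v (Suc (length v))"

definition bit_symbol :: "bool \<Rightarrow> nat" where
  "bit_symbol b = (if b then 3 else 2)"

definition adv :: "nat \<Rightarrow> tape \<Rightarrow> tape" where
  "adv i t = (fst t, snd t + i)"

lemma adv_tape_at [simp]: "adv i (tape_at v h) = tape_at v (h + i)" and adv_adv [simp]: "adv i (adv j t) = adv (j + i) t"
  and adv_0 [simp]: "adv 0 t = t"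
  by (simp_all add: adv_def tape_at_def)

lemma bit_symbol_simps [simp]: "bit_symbol b = 3 \<longleftrightarrow> b" "bit_symbol b = 2 \<longleftrightarrow> \<not> b" "bit_symbol b \<noteq> Suc 0" "bit_symbol b \<noteq> 0"
  by (simp_all add: bit_symbol_def)

lemma tape_content_0 [simp]: "tape_content v 0 = 1"
  and tape_content_Suc: "tape_content v (Suc i) = (if i < length v then bit_symbol (v ! i) else 0)"
  by (simp_all add: tape_content_def bit_symbol_def)

lemma scan_tape_at: "k < K \<Longrightarrow> \<sigma> k = tape_at v h \<Longrightarrow> scan K \<sigma> k = tape_content v h"
  by (simp add: scan_def tape_at_def)

lemma tape_act_write: "tape_act (bit_symbol b, Go_Right) (full v) = full (v @ [b])"
  by (auto simp: tape_at_def fun_eq_iff tape_content_def bit_symbol_def nth_append)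

context
  fixes K B :: nat
begin

lemma tape_act_scan: "k < K \<Longrightarrow> tape_act (scan K \<sigma> k, mv) (\<sigma> k) =
    (fst (\<sigma> k), case mv of Go_Left \<Rightarrow> snd (\<sigma> k) - 1 | Stay \<Rightarrow> snd (\<sigma> k) | Go_Right \<Rightarrow> snd (\<sigma> k) + 1)"
  by (cases "\<sigma> k"; cases mv) (auto simp: scan_def)

lemma runs_emit:
  assumes "W \<subseteq> {..<K}" "R \<subseteq> {..<K}" "\<And>k. k \<in> W \<Longrightarrow> \<sigma> k = full (v k)"
    and "W \<noteq> {} \<Longrightarrow> f (scan K \<sigma>) = bit_symbol b"
  shows "runs K B (emit W f R) \<sigma>
    (\<lambda>k. if k \<in> W then full (v k @ [b]) else if k \<in> R then adv 1 (\<sigma> k) else \<sigma> k)"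
proof -
  have "(if k < K then tape_act (if k \<in> W then (f (scan K \<sigma>), Go_Right)
        else (scan K \<sigma> k, if k \<in> R then Go_Right else Stay)) (\<sigma> k) else \<sigma> k) =
      (if k \<in> W then full (v k @ [b]) else if k \<in> R then adv 1 (\<sigma> k) else \<sigma> k)" for k
  proof (cases "k \<in> W")
    case True
    then have "k < K" "\<sigma> k = full (v k)" "f (scan K \<sigma>) = bit_symbol b" using assms by auto
    then show ?thesis using True tape_act_write[of b "v k"] by simp
  next
    case False
    then show ?thesis using assms(2) by (auto simp: tape_act_scan adv_def)
  qed
  then show ?thesis
    using runs_Act[of K B "\<lambda>r k. if k \<in> W then (f r, Go_Right) else (r k, if k \<in> R then Go_Right else Stay)" \<sigma>]
    by (simp add: emit_def)
qed

lemma runs_advance: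
  "R \<subseteq> {..<K} \<Longrightarrow> runs K B (advance R) \<sigma> (\<lambda>k. if k \<in> R then adv 1 (\<sigma> k) else \<sigma> k)"
  using runs_emit[of "{}" R \<sigma>] by simp

lemma runs_advance1: "j < K \<Longrightarrow> \<sigma> j = tape_at v h \<Longrightarrow> runs K B (advance {j}) \<sigma> (\<sigma>(j := tape_at v (Suc h)))"
  using runs_advance[of "{j}" \<sigma>] by (simp add: fun_upd_def cong: if_cong)

lemma runs_emit1:
  assumes "j < K" "\<sigma> j = full v" "f (scan K \<sigma>) = bit_symbol b"
  shows "runs K B (emit {j} f {}) \<sigma> (\<sigma>(j := full (v @ [b])))"
  using runs_emit[of "{j}" "{}" \<sigma> "\<lambda>_. v" f b] assms by (simp add: fun_upd_def cong: if_cong)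

lemma runs_retreat:
  assumes "j < K" "\<sigma> j = tape_at v (Suc h)"
  shows "runs K B (retreat j) \<sigma> (\<sigma>(j := tape_at v h))"
proof -
  have "(\<lambda>k. if k < K then tape_act (scan K \<sigma> k, if k = j then Go_Left else Stay) (\<sigma> k) else \<sigma> k) = \<sigma>(j := tape_at v h)"
    using assms tape_act_scan[of _ \<sigma>] by (auto simp: fun_eq_iff tape_at_def scan_def)
  then show ?thesis
    using runs_Act[of K B "\<lambda>r k. (r k, if k = j then Go_Left else Stay)" \<sigma>] by (simp add: retreat_def)
qed

lemma runs_rewind:
  assumes "j < K" "\<sigma> j = tape_at v h" "h \<le> B"
  shows "runs K B (rewind j) \<sigma> (\<sigma>(j := tape_at v 1))"
  unfolding rewind_def
proof (rule runs_Seq)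
  have "runs K B (While (\<lambda>r. r j \<noteq> 1) (retreat j)) (\<sigma>(j := tape_at v (h - 0))) (\<sigma>(j := tape_at v (h - h)))"
  proof (rule runs_While[where S = "\<lambda>i. \<sigma>(j := tape_at v (h - i))"])
    fix i assume i: "i < h"
    then obtain l where l: "h - i = Suc l" by (cases "h - i") auto
    then have l': "h - Suc i = l" by simp
    show "scan K (\<sigma>(j := tape_at v (h - i))) j \<noteq> 1"
      using assms(1) by (simp add: scan_tape_at l tape_content_Suc)
    show "runs K B (retreat j) (\<sigma>(j := tape_at v (h - i))) (\<sigma>(j := tape_at v (h - Suc i)))"
      using runs_retreat[of j "\<sigma>(j := tape_at v (Suc l))" v l] assms(1) by (simp add: l l')
  qed (use assms in \<open>simp_all add: scan_tape_at\<close>)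
  then show "runs K B (While (\<lambda>r. r j \<noteq> 1) (retreat j)) \<sigma> (\<sigma>(j := tape_at v 0))"
    using assms(2) by (simp add: fun_upd_idem)
  show "runs K B (advance {j}) (\<sigma>(j := tape_at v 0)) (\<sigma>(j := tape_at v 1))"
    using runs_advance1[of j "\<sigma>(j := tape_at v 0)" v 0] assms(1) by simp
qed

text \<open>Only the end of the run of ones matters, so a unary number works as a counter with or
  without its terminating zero. This lets \<open>Y2\<close> serve both as index and as
  counter.\<close>

definition counter :: "bool list \<Rightarrow> nat \<Rightarrow> bool" where
  "counter c n \<longleftrightarrow> (\<forall>i\<le>n. tape_content c (Suc i) = 3 \<longleftrightarrow> i < n)"

text \<open>The invariant \<open>S i\<close> describes the counter tape as rewound; its true head
  position is patched in by the updates at \<open>k\<close>. The bound is strict because rewinding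
  starts from cell \<open>Suc n\<close>.\<close>

lemma runs_loop:
  assumes "k < K" "n < B" "counter c n"
    and "\<sigma> = S 0" "\<sigma>' = S n" "\<And>i. i \<le> n \<Longrightarrow> S i k = tape_at c 1"
    and "\<And>i. i < n \<Longrightarrow> runs K B p ((S i)(k := tape_at c (Suc i))) ((S (Suc i))(k := tape_at c (Suc i)))"
  shows "runs K B (loop k p) \<sigma> \<sigma>'"
  unfolding loop_def
proof (rule runs_Seq)
  let ?S = "\<lambda>i. (S i)(k := tape_at c (Suc i))"
  have "runs K B (While (\<lambda>r. r k = 3) (p ;; advance {k})) (?S 0) (?S n)"
  proof (rule runs_While[where S = ?S])
    fix i assume i: "i < n"
    then show "scan K (?S i) k = 3"
      using assms(1,3) by (simp add: scan_tape_at counter_def)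
    have "runs K B (advance {k}) ((S (Suc i))(k := tape_at c (Suc i))) (?S (Suc i))"
      using runs_advance1[of k "(S (Suc i))(k := tape_at c (Suc i))" c "Suc i"] assms(1) by simp
    then show "runs K B (p ;; advance {k}) (?S i) (?S (Suc i))"
      by (rule runs_Seq[OF assms(7)[OF i]])
  qed (use assms(1-3) in \<open>simp_all add: scan_tape_at counter_def\<close>)
  then show "runs K B (While (\<lambda>r. r k = 3) (p ;; advance {k})) \<sigma> (?S n)"
    using assms(4) assms(6)[of 0] by (simp add: fun_upd_idem)
  show "runs K B (rewind k) (?S n) \<sigma>'"
    using runs_rewind[of k "?S n" c "Suc n"] assms(1,2,5) assms(6)[of n] by (simp add: fun_upd_idem)
qed

text \<open>The premise on \<open>f\<close> concerns any state \<open>\<tau>\<close> that is known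
  off the written tapes and the counter, with the heads in \<open>R\<close> moved by
  \<open>i\<close>, so that a user never has to describe the growing output.\<close>

lemma runs_loop_emit:
  assumes "k < K" "n < B" "counter c n" "\<sigma> k = tape_at c 1"
    and "W \<subseteq> {..<K}" "R \<subseteq> {..<K}" "W \<inter> R = {}" "k \<notin> W" "k \<notin> R"
    and "\<And>j. j \<in> W \<Longrightarrow> \<sigma> j = full (v j)"
    and "\<And>i \<tau>. W \<noteq> {} \<Longrightarrow> i < n \<Longrightarrow> (\<And>j. j \<in> R \<Longrightarrow> \<tau> j = adv i (\<sigma> j)) \<Longrightarrow>
      (\<And>j. j \<notin> R \<Longrightarrow> j \<notin> W \<Longrightarrow> j \<noteq> k \<Longrightarrow> \<tau> j = \<sigma> j) \<Longrightarrow> f (scan K \<tau>) = bit_symbol (g i)"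
    and "\<sigma>' = (\<lambda>j. if j \<in> W then full (v j @ map g [0..<n]) else if j \<in> R then adv n (\<sigma> j) else \<sigma> j)"
  shows "runs K B (loop k (emit W f R)) \<sigma> \<sigma>'"
proof (rule runs_loop[OF assms(1-3), where
      S = "\<lambda>i j. if j \<in> W then full (v j @ map g [0..<i]) else if j \<in> R then adv i (\<sigma> j) else \<sigma> j"])
  let ?S = "\<lambda>i j. if j \<in> W then full (v j @ map g [0..<i]) else if j \<in> R then adv i (\<sigma> j) else \<sigma> j"
  fix i assume i: "i < n"
  let ?\<tau> = "(?S i)(k := tape_at c (Suc i))"
  have "f (scan K ?\<tau>) = bit_symbol (g i)" if "W \<noteq> {}"
    using assms(7-9) by (intro assms(11)[OF that i]) auto
  then have "runs K B (emit W f R) ?\<tau> (\<lambda>j. if j \<in> W then full ((v j @ map g [0..<i]) @ [g i])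
      else if j \<in> R then adv 1 (?\<tau> j) else ?\<tau> j)"
    using assms(5,6,8) by (intro runs_emit) auto
  moreover have "(\<lambda>j. if j \<in> W then full ((v j @ map g [0..<i]) @ [g i])
      else if j \<in> R then adv 1 (?\<tau> j) else ?\<tau> j) = (?S (Suc i))(k := tape_at c (Suc i))"
    using assms(7-9) by (auto simp: fun_eq_iff)
  ultimately show "runs K B (emit W f R) ?\<tau> ((?S (Suc i))(k := tape_at c (Suc i)))" by simp
qed (use assms(4,8-10,12) in \<open>auto simp: fun_eq_iff\<close>)

lemma runs_loop_advance:
  assumes "k < K" "n < B" "counter c n" "\<sigma> k = tape_at c 1" "j < K" "j \<noteq> k" "\<sigma> j = tape_at v h"
  shows "runs K B (loop k (advance {j})) \<sigma> (\<sigma>(j := tape_at v (h + n)))"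
  using assms by (intro runs_loop_emit[where W = "{}" and n = n]) auto

lemma runs_loop_retreat:
  assumes "k < K" "n < B" "counter c n" "\<sigma> k = tape_at c 1" "j < K" "j \<noteq> k" "\<sigma> j = tape_at v (h + n)"
  shows "runs K B (loop k (retreat j)) \<sigma> (\<sigma>(j := tape_at v h))"
proof (rule runs_loop[OF assms(1-3), where S = "\<lambda>i. \<sigma>(j := tape_at v (h + (n - i)))"])
  fix i assume i: "i < n"
  then have "n - i = Suc (n - Suc i)" by simp
  then show "runs K B (retreat j) (\<sigma>(j := tape_at v (h + (n - i)), k := tape_at c (Suc i)))
      (\<sigma>(j := tape_at v (h + (n - Suc i)), k := tape_at c (Suc i)))"
    using runs_retreat[of j "\<sigma>(j := tape_at v (h + (n - i)), k := tape_at c (Suc i))" v "h + (n - Suc i)"] assms(5,6)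
    by (simp add: fun_upd_twist)
qed (use assms in \<open>simp_all add: fun_upd_idem\<close>)

lemma runs_loop2_advance:
  assumes "k < K" "n < B" "counter c n" "\<sigma> k = tape_at c 1" "k' < K" "n' < B" "counter c' n'" "\<sigma> k' = tape_at c' 1"
    and "j < K" "j \<noteq> k" "j \<noteq> k'" "k \<noteq> k'" "\<sigma> j = tape_at v h"
  shows "runs K B (loop k (loop k' (advance {j}))) \<sigma> (\<sigma>(j := tape_at v (h + n * n')))"
proof (rule runs_loop[OF assms(1-3), where S = "\<lambda>i. \<sigma>(j := tape_at v (h + i * n'))"])
  fix i
  show "runs K B (loop k' (advance {j})) (\<sigma>(j := tape_at v (h + i * n'), k := tape_at c (Suc i)))
      (\<sigma>(j := tape_at v (h + Suc i * n'), k := tape_at c (Suc i)))"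
    using runs_loop_advance[of k' n' c' "\<sigma>(j := tape_at v (h + i * n'), k := tape_at c (Suc i))" j v "h + i * n'"] assms
    by (simp add: fun_upd_twist add.commute add.left_commute)
qed (use assms in \<open>simp_all add: fun_upd_idem\<close>)

lemma runs_loop2_retreat:
  assumes "k < K" "n < B" "counter c n" "\<sigma> k = tape_at c 1" "k' < K" "n' < B" "counter c' n'" "\<sigma> k' = tape_at c' 1"
    and "j < K" "j \<noteq> k" "j \<noteq> k'" "k \<noteq> k'" "\<sigma> j = tape_at v (h + n * n')"
  shows "runs K B (loop k (loop k' (retreat j))) \<sigma> (\<sigma>(j := tape_at v h))"
proof (rule runs_loop[OF assms(1-3), where S = "\<lambda>i. \<sigma>(j := tape_at v (h + (n - i) * n'))"])
  fix i assume i: "i < n"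
  then have "n - i = Suc (n - Suc i)" by simp
  then show "runs K B (loop k' (retreat j)) (\<sigma>(j := tape_at v (h + (n - i) * n'), k := tape_at c (Suc i)))
      (\<sigma>(j := tape_at v (h + (n - Suc i) * n'), k := tape_at c (Suc i)))"
    using runs_loop_retreat[of k' n' c' "\<sigma>(j := tape_at v (h + (n - i) * n'), k := tape_at c (Suc i))" j v
        "h + (n - Suc i) * n'"] assms
    by (simp add: fun_upd_twist add.commute add.left_commute)
qed (use assms in \<open>simp_all add: fun_upd_idem\<close>)

lemma runs_loop2_copy:
  assumes "k < K" "n < B" "counter c n" "\<sigma> k = tape_at c 1" "k' < K" "n' < B" "counter c' n'" "\<sigma> k' = tape_at c' 1"
    and "j < K" "l < K" "distinct [k, k', j, l]" "\<sigma> j = tape_at w (Suc (length u))" "\<sigma> l = full []"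
    and "w = u @ bs @ u'" "length bs = n * n'"
  shows "runs K B (loop k (loop k' (emit {l} (\<lambda>r. r j) {j}))) \<sigma>
    (\<sigma>(j := tape_at w (Suc (length u + n * n')), l := full bs))"
proof (rule runs_loop[OF assms(1-3), where
      S = "\<lambda>i. \<sigma>(j := tape_at w (Suc (length u + i * n')), l := full (take (i * n') bs))"])
  fix i assume i: "i < n"
  let ?\<tau> = "\<sigma>(j := tape_at w (Suc (length u + i * n')), l := full (take (i * n') bs), k := tape_at c (Suc i))"
  \<comment> \<open>The \<open>i\<close>-th block lies entirely within \<open>bs\<close>, so the
    source head reads bits of \<open>bs\<close> and not the rest \<open>u'\<close> of the
    tape.\<close>
  have le: "i * n' + n' \<le> length bs"
    using mult_right_mono[of "Suc i" n n'] i assms(15) by (simp add: add.commute)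
  have "take (i * n') bs @ map (\<lambda>i'. bs ! (i * n' + i')) [0..<n'] = take (i * n' + n') bs"
    using le by (simp add: list_eq_iff_nth_eq nth_append less_diff_conv2)
  moreover have "scan K \<tau> j = bit_symbol (bs ! (i * n' + i'))"
    if "i' < n'" "\<tau> j = adv i' (?\<tau> j)" for \<tau> i'
    using that assms(9,11,14) le by (simp add: scan_tape_at tape_content_Suc nth_append)
  ultimately show "runs K B (loop k' (emit {l} (\<lambda>r. r j) {j})) ?\<tau>
      (\<sigma>(j := tape_at w (Suc (length u + Suc i * n')), l := full (take (Suc i * n') bs), k := tape_at c (Suc i)))"
    using assms le
    by (intro runs_loop_emit[where v = "\<lambda>_. take (i * n') bs" and n = n' and c = c'
          and g = "\<lambda>i'. bs ! (i * n' + i')"]) (auto simp: fun_eq_iff add.commute add.left_commute)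
qed (use assms in \<open>auto simp: fun_eq_iff\<close>)

end


section \<open>The machine computing the reduction\<close>

text \<open>
  \<open>N1\<close>, \<open>N2\<close>, \<open>N3\<close> hold \<open>n\<close> and \<open>M1\<close>, \<open>M2\<close> hold \<open>m\<close> in unary, since nested loops need separate counters. \<open>XT\<close>, \<open>Y1\<close>
  and \<open>Y2\<close> hold \<open>x\<close> and \<open>y\<close> with the terminating zero, so that a head moved in step with a row or column
  index reads the symbol 2 exactly at row or column \<open>x\<close> or \<open>y\<close>.
\<close>

abbreviation (input) "IN \<equiv> 0 :: nat"
abbreviation (input) "N1 \<equiv> 1 :: nat"
abbreviation (input) "N2 \<equiv> 2 :: nat"
abbreviation (input) "N3 \<equiv> 3 :: nat"
abbreviation (input) "PT \<equiv> 4 :: nat"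
abbreviation (input) "M1 \<equiv> 5 :: nat"
abbreviation (input) "M2 \<equiv> 6 :: nat"
abbreviation (input) "QT \<equiv> 7 :: nat"
abbreviation (input) "XT \<equiv> 8 :: nat"
abbreviation (input) "Y1 \<equiv> 9 :: nat"
abbreviation (input) "Y2 \<equiv> 10 :: nat"
abbreviation (input) "OUT \<equiv> 11 :: nat"

abbreviation unary :: "nat \<Rightarrow> bool list" where
  "unary n \<equiv> replicate n True"

definition matrix_bits :: "nat \<Rightarrow> (nat \<times> nat) set \<Rightarrow> bool list" where
  "matrix_bits k lt = concat (map (\<lambda>i. map (\<lambda>j. (i, j) \<in> lt) [0..<k]) [0..<k])"

lemma length_concat_map_upt: "length (concat (map (\<lambda>i. map (f i) [0..<m]) [0..<n])) = n * m"
  by (induction n) auto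

lemma nth_concat_map_upt:
  "i < n \<Longrightarrow> j < m \<Longrightarrow> concat (map (\<lambda>i. map (f i) [0..<m]) [0..<n]) ! (i * m + j) = f i j"
proof (induction n)
  case (Suc n)
  have "i * m + j < n * m" if "i < n"
    using mult_right_mono[of "Suc i" n m] that Suc.prems by simp
  then show ?case
    using Suc by (auto simp: nth_append length_concat_map_upt less_Suc_eq)
qed simp

lemma length_matrix_bits [simp]: "length (matrix_bits k lt) = k * k"
  by (simp add: matrix_bits_def length_concat_map_upt)

lemma nth_matrix_bits: "i < k \<Longrightarrow> j < k \<Longrightarrow> matrix_bits k lt ! (i * k + j) \<longleftrightarrow> (i, j) \<in> lt"
  by (simp add: matrix_bits_def nth_concat_map_upt)

lemma counter_unary [simp]: "counter (unary n) n" "counter (unary n @ [False]) n"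
  by (auto simp: counter_def tape_content_Suc nth_append)

lemma terminator_iff: "tape_content (unary n @ [False]) (Suc i) = 2 \<longleftrightarrow> i = n"
  by (auto simp: tape_content_Suc nth_append)

lemma runs_eq: "runs K B p \<sigma> \<tau> \<Longrightarrow> \<tau> = \<tau>' \<Longrightarrow> runs K B p \<sigma> \<tau>'"
  by simp

text \<open>All copies of a counter are filled in one pass. The head on \<open>IN\<close> stops on
  the terminating zero, which the caller skips, appending a zero of its own where the copy needs a
  terminator.\<close>

definition read_unary :: "nat set \<Rightarrow> prog" where
  "read_unary W = While (\<lambda>r. r IN = 3) (emit W (\<lambda>_. 3) {IN})"

lemma runs_read_unary:
  assumes "W \<subseteq> {..<K}" "0 < K" "IN \<notin> W" "\<sigma> IN = tape_at w (Suc (length u))" "w = u @ unary n @ False # v"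
    and "n \<le> B" "\<And>k. k \<in> W \<Longrightarrow> \<sigma> k = full []"
  shows "runs K B (read_unary W) \<sigma>
    (\<lambda>k. if k \<in> W then full (unary n) else if k = IN then tape_at w (Suc (length u + n)) else \<sigma> k)"
proof -
  let ?S = "\<lambda>i k. if k \<in> W then full (unary i) else if k = IN then tape_at w (Suc (length u + i)) else \<sigma> k"
  have scan: "scan K (?S i) IN = (if i < n then 3 else 2)" if "i \<le> n" for i
    using assms(2,3,5) that by (simp add: scan_tape_at[where h = "Suc (length u + i)" and v = w]
        tape_content_Suc nth_append bit_symbol_def)
  have "runs K B (While (\<lambda>r. r IN = 3) (emit W (\<lambda>_. 3) {IN})) (?S 0) (?S n)"
  proof (rule runs_While[OF assms(6), where S = ?S])
    fix i assume "i < n"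
    have "runs K B (emit W (\<lambda>_. 3) {IN}) (?S i)
        (\<lambda>k. if k \<in> W then full (unary i @ [True]) else if k \<in> {IN} then adv 1 (?S i k) else ?S i k)"
      using assms(1,2) by (intro runs_emit) (auto simp: bit_symbol_def)
    then show "runs K B (emit W (\<lambda>_. 3) {IN}) (?S i) (?S (Suc i))"
      by (rule runs_eq) (use assms(3) in \<open>auto simp: fun_eq_iff replicate_append_same\<close>)
  qed (use scan in auto)
  moreover have "?S 0 = \<sigma>" using assms(4,7) by (auto simp: fun_eq_iff)
  ultimately show ?thesis by (simp add: read_unary_def)
qed

text \<open>\<open>P\<close> enters the matrix transposed: a row is read off \<open>PT\<close> with stride \<open>n\<close>.\<close>

definition column_prog :: prog where
  "column_prog = loop N2 (emit {OUT} (\<lambda>r. r PT) {} ;; loop N3 (advance {PT}))"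

text \<open>A column moves \<open>PT\<close> by \<open>n\<close> strides of length \<open>n\<close>;
  these \<open>n * n\<close> cells are undone so that one step right reaches the next column.
  \<open>QT\<close> runs along its row in every pass, although only row \<open>x\<close> prints it,
  and so always goes back \<open>m\<close> cells.\<close>

definition lower_row_prog :: prog where
  "lower_row_prog =
     column_prog ;; loop N2 (loop N3 (retreat PT)) ;;
     loop M2 (emit {OUT} (\<lambda>r. if r XT = 2 then r QT else 3) {QT}) ;; loop M2 (retreat QT) ;;
     advance {PT, XT}"

text \<open>\<open>QT\<close> advances even in row \<open>y\<close>, where its bits are replaced by
  ones off the diagonal, and so stays in step with the row-major matrix. \<open>Y1\<close> follows
  the row index and \<open>Y2\<close> the column index.\<close>

definition upper_row_prog :: prog where
  "upper_row_prog =
     loop N1 (emit {OUT} (\<lambda>_. 2) {}) ;;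
     loop M2 (emit {OUT} (\<lambda>r. if r Y1 = 2 then if r Y2 = 2 then 2 else 3 else r QT) {QT, Y2}) ;;
     rewind Y2 ;; advance {Y1}"

text \<open>Only row \<open>x\<close> of the lower part reads \<open>Q\<close>, so \<open>QT\<close> stays at row \<open>y\<close> while the lower rows are written.\<close>

definition output_prog :: prog where
  "output_prog =
     loop N1 (emit {OUT} (\<lambda>_. 3) {}) ;; loop M1 (emit {OUT} (\<lambda>_. 3) {}) ;; emit {OUT} (\<lambda>_. 2) {} ;;
     loop Y2 (loop M1 (advance {QT})) ;; loop N1 lower_row_prog ;; rewind QT ;; loop M1 upper_row_prog ;;
     loop N1 (emit {OUT} (\<lambda>_. 3) {}) ;; loop Y2 (emit {OUT} (\<lambda>_. 3) {}) ;; emit {OUT} (\<lambda>_. 2) {} ;;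
     loop N1 (emit {OUT} (\<lambda>_. 3) {}) ;; emit {OUT} (\<lambda>_. 2) {}"

text \<open>All heads start on the end marker in cell 0, hence the initial advance. Each matrix is
  copied by nested loops over the counters just read.\<close>

definition parse_prog :: prog where
  "parse_prog =
     advance {..<12} ;;
     read_unary {N1, N2, N3} ;; advance {IN} ;; rewind N1 ;; rewind N2 ;; rewind N3 ;;
     loop N1 (loop N2 (emit {PT} (\<lambda>r. r IN) {IN})) ;; rewind PT ;;
     read_unary {M1, M2} ;; advance {IN} ;; rewind M1 ;; rewind M2 ;;
     loop M1 (loop M2 (emit {QT} (\<lambda>r. r IN) {IN})) ;; rewind QT ;;
     read_unary {XT} ;; emit {XT} (\<lambda>_. 2) {IN} ;; rewind XT ;;
     read_unary {Y1, Y2} ;; emit {Y1, Y2} (\<lambda>_. 2) {IN} ;; rewind Y1 ;; rewind Y2"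

lemma wf_read_unary [simp]: "wf_prog (read_unary W)"
  by (simp add: read_unary_def wf_emit)

lemma wf_prog_parse_output: "wf_prog (parse_prog ;; output_prog)"
  by (simp add: parse_prog_def output_prog_def upper_row_prog_def lower_row_prog_def column_prog_def wf_emit)

lemma upt_add_eq_append_map: "[0..<n + m] = [0..<n] @ map ((+) n) [0..<m]"
  by (rule nth_equalityI) (auto simp: nth_append)

section \<open>Correctness of the parsing and output programs\<close>

context
  fixes B n m x y :: nat and ltP ltQ :: "(nat \<times> nat) set"
  assumes x: "x < n" and y: "y < m" and B: "n * n + 1 \<le> B" "m * m + 1 \<le> B"
begin

private abbreviation (input) "P \<equiv> matrix_bits n ltP"
private abbreviation (input) "Q \<equiv> matrix_bits m ltQ"
private abbreviation (input) "below \<equiv> glued_less n ltP ltQ x y"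
private abbreviation (input) "row a \<equiv> map (below a) [0..<n + m]"

text \<open>The longest trips are the rewinds of \<open>PT\<close> and \<open>QT\<close> from cells
  \<open>n * n + 1\<close> and \<open>m * m + 1\<close> after copying; everything else fits because
  a number is at most its square.\<close>

private lemma bounds: "n < B" "m < B" "x < B" "y < B" "m * m < B" "n * n < B" "Suc m \<le> B"
proof -
  have "n \<le> n * n" "m \<le> m * m" by auto
  then show "n < B" "m < B" "x < B" "y < B" "m * m < B" "n * n < B" "Suc m \<le> B"
    using x y B by linarith+
qed

private lemma row_lower:
  "a < n \<Longrightarrow> row a = map (\<lambda>b. (b, a) \<in> ltP) [0..<n] @ map (\<lambda>b. a = x \<longrightarrow> (y, b) \<in> ltQ) [0..<m]"
  by (auto simp: upt_add_eq_append_map glued_less_def)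

private lemma row_upper:
  "row (n + a) = map (\<lambda>_. False) [0..<n] @ map (\<lambda>b. if a = y then b \<noteq> y else (a, b) \<in> ltQ) [0..<m]"
  by (auto simp: upt_add_eq_append_map glued_less_def)

text \<open>The bit of the pair \<open>(b, a)\<close> sits in cell \<open>Suc a + b * n\<close>, so
  strides of \<open>n\<close> starting from cell \<open>Suc a\<close> list column
  \<open>a\<close>.\<close>

private lemma runs_column:
  assumes "\<sigma> N2 = tape_at (unary n) 1" "\<sigma> N3 = tape_at (unary n) 1" "\<sigma> PT = tape_at P (Suc a)"
    and "\<sigma> OUT = full out" "a < n"
  shows "runs 12 B column_prog \<sigma>
    (\<sigma>(PT := tape_at P (Suc a + n * n), OUT := full (out @ map (\<lambda>b. (b, a) \<in> ltP) [0..<n])))"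
  unfolding column_prog_def
proof (rule runs_loop[where n = n and c = "unary n" and
      S = "\<lambda>i. \<sigma>(PT := tape_at P (Suc a + i * n), OUT := full (out @ map (\<lambda>b. (b, a) \<in> ltP) [0..<i]))"])
  let ?S = "\<lambda>i. \<sigma>(PT := tape_at P (Suc a + i * n), OUT := full (out @ map (\<lambda>b. (b, a) \<in> ltP) [0..<i]))"
  fix i assume i: "i < n"
  let ?\<tau> = "(?S i)(N2 := tape_at (unary n) (Suc i))"
  let ?\<tau>' = "?\<tau>(OUT := full ((out @ map (\<lambda>b. (b, a) \<in> ltP) [0..<i]) @ [(i, a) \<in> ltP]))"
  have "i * n + a < n * n"
    using mult_right_mono[of "Suc i" n n] i assms(5) by simp
  then have "runs 12 B (emit {OUT} (\<lambda>r. r PT) {}) ?\<tau> ?\<tau>'"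
    using i assms(5) nth_matrix_bits[of i n a ltP]
    by (intro runs_emit1) (simp_all add: scan_tape_at tape_content_Suc add.commute)
  moreover have "runs 12 B (loop N3 (advance {PT})) ?\<tau>' (?\<tau>'(PT := tape_at P (Suc a + i * n + n)))"
    using assms(2) bounds by (intro runs_loop_advance[where c = "unary n" and n = n]) simp_all
  ultimately have "runs 12 B (emit {OUT} (\<lambda>r. r PT) {} ;; loop N3 (advance {PT})) ?\<tau>
      (?\<tau>'(PT := tape_at P (Suc a + i * n + n)))"
    by (rule runs_Seq)
  then show "runs 12 B (emit {OUT} (\<lambda>r. r PT) {} ;; loop N3 (advance {PT})) ?\<tau>
      ((?S (Suc i))(N2 := tape_at (unary n) (Suc i)))"
    by (rule runs_eq) (auto simp: fun_eq_iff algebra_simps)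
qed (use assms bounds in \<open>auto simp: fun_eq_iff\<close>)

private lemma runs_lower_row:
  assumes "\<sigma> N2 = tape_at (unary n) 1" "\<sigma> N3 = tape_at (unary n) 1" "\<sigma> PT = tape_at P (Suc a)"
    and "\<sigma> M2 = tape_at (unary m) 1" "\<sigma> QT = tape_at Q (Suc (y * m))"
    and "\<sigma> XT = tape_at (unary x @ [False]) (Suc a)" "\<sigma> OUT = full out" "a < n"
  shows "runs 12 B lower_row_prog \<sigma>
    (\<sigma>(PT := tape_at P (Suc (Suc a)), XT := tape_at (unary x @ [False]) (Suc (Suc a)), OUT := full (out @ row a)))"
proof -
  define out1 where "out1 = out @ map (\<lambda>b. (b, a) \<in> ltP) [0..<n]"
  define \<sigma>1 where "\<sigma>1 = \<sigma>(PT := tape_at P (Suc a + n * n), OUT := full out1)"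
  define \<sigma>2 where "\<sigma>2 = \<sigma>1(PT := tape_at P (Suc a))"
  define \<sigma>3 where "\<sigma>3 = \<sigma>2(QT := tape_at Q (Suc (y * m) + m), OUT := full (out @ row a))"
  define \<sigma>4 where "\<sigma>4 = \<sigma>3(QT := tape_at Q (Suc (y * m)))"
  have "runs 12 B column_prog \<sigma> \<sigma>1"
    unfolding \<sigma>1_def out1_def using assms by (intro runs_column) simp_all
  moreover have "runs 12 B (loop N2 (loop N3 (retreat PT))) \<sigma>1 \<sigma>2"
    unfolding \<sigma>2_def using assms bounds
    by (intro runs_loop2_retreat[where c = "unary n" and c' = "unary n" and n = n and n' = n])
      (simp_all add: \<sigma>1_def)
  moreover have "runs 12 B (loop M2 (emit {OUT} (\<lambda>r. if r XT = 2 then r QT else 3) {QT})) \<sigma>2 \<sigma>3"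
  proof (rule runs_loop_emit[where n = m and c = "unary m" and g = "\<lambda>b. a = x \<longrightarrow> (y, b) \<in> ltQ" and v = "\<lambda>_. out1"])
    fix i \<tau> assume i: "i < m" and \<tau>: "\<And>j. j \<in> {QT} \<Longrightarrow> \<tau> j = adv i (\<sigma>2 j)"
      "\<And>j. j \<notin> {QT} \<Longrightarrow> j \<notin> {OUT} \<Longrightarrow> j \<noteq> M2 \<Longrightarrow> \<tau> j = \<sigma>2 j"
    have "\<tau> XT = tape_at (unary x @ [False]) (Suc a)"
      using \<tau>(2)[of XT] assms(6) by (simp add: \<sigma>2_def \<sigma>1_def)
    moreover have "\<tau> QT = tape_at Q (Suc (y * m + i))"
      using \<tau>(1)[of QT] assms(5) by (simp add: \<sigma>2_def \<sigma>1_def)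
    moreover have "y * m + i < m * m"
      using mult_right_mono[of "Suc y" m m] i y by simp
    ultimately show "(if scan 12 \<tau> XT = 2 then scan 12 \<tau> QT else 3) = bit_symbol (a = x \<longrightarrow> (y, i) \<in> ltQ)"
      using i y nth_matrix_bits[of y m i ltQ]
      by (auto simp: scan_tape_at terminator_iff tape_content_Suc[of Q] bit_symbol_def)
  qed (use assms bounds in \<open>auto simp: fun_eq_iff \<sigma>3_def \<sigma>2_def \<sigma>1_def out1_def row_lower\<close>)
  moreover have "runs 12 B (loop M2 (retreat QT)) \<sigma>3 \<sigma>4"
    unfolding \<sigma>4_def using assms bounds
    by (intro runs_loop_retreat[where c = "unary m" and n = m]) (simp_all add: \<sigma>3_def \<sigma>2_def \<sigma>1_def)
  moreover have "runs 12 B (advance {PT, XT}) \<sigma>4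
      (\<sigma>(PT := tape_at P (Suc (Suc a)), XT := tape_at (unary x @ [False]) (Suc (Suc a)), OUT := full (out @ row a)))"
    by (rule runs_eq[OF runs_advance])
      (use assms in \<open>auto simp: fun_eq_iff \<sigma>4_def \<sigma>3_def \<sigma>2_def \<sigma>1_def\<close>)
  ultimately show ?thesis
    unfolding lower_row_prog_def by (meson runs_Seq)
qed

private lemma runs_upper_row:
  assumes "\<sigma> N1 = tape_at (unary n) 1" "\<sigma> M2 = tape_at (unary m) 1" "\<sigma> QT = tape_at Q (Suc (a * m))"
    and "\<sigma> Y1 = tape_at (unary y @ [False]) (Suc a)" "\<sigma> Y2 = tape_at (unary y @ [False]) 1"
    and "\<sigma> OUT = full out" "a < m"
  shows "runs 12 B upper_row_prog \<sigma>
    (\<sigma>(QT := tape_at Q (Suc (Suc a * m)), Y1 := tape_at (unary y @ [False]) (Suc (Suc a)),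
       OUT := full (out @ row (n + a))))"
proof -
  define out1 where "out1 = out @ map (\<lambda>_. False) [0..<n]"
  define \<sigma>1 where "\<sigma>1 = \<sigma>(OUT := full out1)"
  define \<sigma>2 where "\<sigma>2 = \<sigma>1(QT := tape_at Q (Suc (Suc a * m)), Y2 := tape_at (unary y @ [False]) (Suc m),
    OUT := full (out @ row (n + a)))"
  define \<sigma>3 where "\<sigma>3 = \<sigma>2(Y2 := tape_at (unary y @ [False]) 1)"
  have "runs 12 B (loop N1 (emit {OUT} (\<lambda>_. 2) {})) \<sigma> \<sigma>1"
    using assms bounds
    by (intro runs_loop_emit[where n = n and c = "unary n" and g = "\<lambda>_. False" and v = "\<lambda>_. out"])
      (auto simp: fun_eq_iff \<sigma>1_def out1_def bit_symbol_def)
  moreover have "runs 12 B (loop M2 (emit {OUT}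
      (\<lambda>r. if r Y1 = 2 then if r Y2 = 2 then 2 else 3 else r QT) {QT, Y2})) \<sigma>1 \<sigma>2"
  proof (rule runs_loop_emit[where n = m and c = "unary m" and v = "\<lambda>_. out1"
        and g = "\<lambda>b. if a = y then b \<noteq> y else (a, b) \<in> ltQ"])
    fix i \<tau> assume i: "i < m" and \<tau>: "\<And>j. j \<in> {QT, Y2} \<Longrightarrow> \<tau> j = adv i (\<sigma>1 j)"
      "\<And>j. j \<notin> {QT, Y2} \<Longrightarrow> j \<notin> {OUT} \<Longrightarrow> j \<noteq> M2 \<Longrightarrow> \<tau> j = \<sigma>1 j"
    have "\<tau> Y1 = tape_at (unary y @ [False]) (Suc a)"
      using \<tau>(2)[of Y1] assms(4) by (simp add: \<sigma>1_def)
    moreover have "\<tau> Y2 = tape_at (unary y @ [False]) (Suc i)"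
      using \<tau>(1)[of Y2] assms(5) by (simp add: \<sigma>1_def)
    moreover have "\<tau> QT = tape_at Q (Suc (a * m + i))"
      using \<tau>(1)[of QT] assms(3) by (simp add: \<sigma>1_def)
    moreover have "a * m + i < m * m"
      using mult_right_mono[of "Suc a" m m] i assms(7) by simp
    ultimately show "(if scan 12 \<tau> Y1 = 2 then if scan 12 \<tau> Y2 = 2 then 2 else 3 else scan 12 \<tau> QT) =
        bit_symbol (if a = y then i \<noteq> y else (a, i) \<in> ltQ)"
      using i assms(7) nth_matrix_bits[of a m i ltQ]
      by (auto simp: scan_tape_at terminator_iff tape_content_Suc[of Q] bit_symbol_def)
  qed (use assms bounds in \<open>auto simp: fun_eq_iff \<sigma>2_def \<sigma>1_def out1_def row_upper add.commute[of "a * m"]\<close>)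
  moreover have "runs 12 B (rewind Y2) \<sigma>2 \<sigma>3"
    unfolding \<sigma>3_def using bounds by (intro runs_rewind[where h = "Suc m"]) (simp_all add: \<sigma>2_def)
  moreover have "runs 12 B (advance {Y1}) \<sigma>3
      (\<sigma>(QT := tape_at Q (Suc (Suc a * m)), Y1 := tape_at (unary y @ [False]) (Suc (Suc a)),
       OUT := full (out @ row (n + a))))"
    by (rule runs_eq[OF runs_advance])
      (use assms in \<open>auto simp: fun_eq_iff \<sigma>3_def \<sigma>2_def \<sigma>1_def\<close>)
  ultimately show ?thesis
    unfolding upper_row_prog_def by (meson runs_Seq)
qed

private lemma runs_print_unary:
  assumes "k < 11" "l < B" "counter c l" "\<sigma> k = tape_at c 1" "\<sigma> OUT = full out"
  shows "runs 12 B (loop k (emit {OUT} (\<lambda>_. 3) {})) \<sigma> (\<sigma>(OUT := full (out @ unary l)))"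
  using assms
  by (intro runs_loop_emit[where n = l and c = c and g = "\<lambda>_. True" and v = "\<lambda>_. out"])
    (auto simp: fun_eq_iff bit_symbol_def map_replicate_const)

private lemma runs_print_False:
  "\<sigma> OUT = full out \<Longrightarrow> runs 12 B (emit {OUT} (\<lambda>_. 2) {}) \<sigma> (\<sigma>(OUT := full (out @ [False])))"
  by (rule runs_emit1) (simp_all add: bit_symbol_def)

private lemma runs_output:
  assumes "\<sigma> N1 = tape_at (unary n) 1" "\<sigma> N2 = tape_at (unary n) 1" "\<sigma> N3 = tape_at (unary n) 1"
    and "\<sigma> M1 = tape_at (unary m) 1" "\<sigma> M2 = tape_at (unary m) 1"
    and "\<sigma> PT = tape_at P 1" "\<sigma> QT = tape_at Q 1" "\<sigma> XT = tape_at (unary x @ [False]) 1"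
    and "\<sigma> Y1 = tape_at (unary y @ [False]) 1" "\<sigma> Y2 = tape_at (unary y @ [False]) 1" "\<sigma> OUT = full []"
  shows "\<exists>\<sigma>'. runs 12 B output_prog \<sigma> \<sigma>' \<and>
    \<sigma>' OUT = full (enc_nat (n + m) @ concat (map row [0..<n + m]) @ enc_nat (n + y) @ enc_nat n)"
proof -
  define \<sigma>1 where "\<sigma>1 = \<sigma>(OUT := full (unary n))"
  define \<sigma>2 where "\<sigma>2 = \<sigma>1(OUT := full (unary n @ unary m))"
  define \<sigma>3 where "\<sigma>3 = \<sigma>2(OUT := full (enc_nat (n + m)))"
  define \<sigma>4 where "\<sigma>4 = \<sigma>3(QT := tape_at Q (Suc (y * m)))"
  \<comment> \<open>\<open>\<sigma>5 i\<close> is the state after \<open>i\<close> lower rows and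
    \<open>\<sigma>7 i\<close> the one after \<open>i\<close> upper rows: the invariants of the two
    row loops.\<close>
  define \<sigma>5 where "\<sigma>5 = (\<lambda>i. \<sigma>4(PT := tape_at P (Suc i), XT := tape_at (unary x @ [False]) (Suc i),
    OUT := full (enc_nat (n + m) @ concat (map row [0..<i]))))"
  define \<sigma>6 where "\<sigma>6 = (\<sigma>5 n)(QT := tape_at Q 1)"
  define \<sigma>7 where "\<sigma>7 = (\<lambda>i. \<sigma>6(QT := tape_at Q (Suc (i * m)), Y1 := tape_at (unary y @ [False]) (Suc i),
    OUT := full (enc_nat (n + m) @ concat (map row [0..<n + i]))))"
  define out where "out = enc_nat (n + m) @ concat (map row [0..<n + m])"
  define \<sigma>8 where "\<sigma>8 = (\<sigma>7 m)(OUT := full (out @ unary n))"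
  define \<sigma>9 where "\<sigma>9 = \<sigma>8(OUT := full (out @ unary n @ unary y))"
  define \<sigma>10 where "\<sigma>10 = \<sigma>9(OUT := full (out @ enc_nat (n + y)))"
  define \<sigma>11 where "\<sigma>11 = \<sigma>10(OUT := full (out @ enc_nat (n + y) @ unary n))"
  define \<sigma>12 where "\<sigma>12 = \<sigma>11(OUT := full (out @ enc_nat (n + y) @ enc_nat n))"
  note defs = \<sigma>1_def \<sigma>2_def \<sigma>3_def \<sigma>4_def \<sigma>5_def \<sigma>6_def \<sigma>7_def \<sigma>8_def \<sigma>9_def \<sigma>10_def \<sigma>11_def
  have "runs 12 B (loop N1 (emit {OUT} (\<lambda>_. 3) {})) \<sigma> \<sigma>1"
    using runs_print_unary[of N1 n "unary n" \<sigma> "[]"] assms bounds by (simp add: \<sigma>1_def)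
  moreover have "runs 12 B (loop M1 (emit {OUT} (\<lambda>_. 3) {})) \<sigma>1 \<sigma>2"
    using runs_print_unary[of M1 m "unary m" \<sigma>1 "unary n"] assms bounds by (simp add: \<sigma>2_def \<sigma>1_def)
  moreover have "runs 12 B (emit {OUT} (\<lambda>_. 2) {}) \<sigma>2 \<sigma>3"
    using runs_print_False[of \<sigma>2 "unary n @ unary m"]
    by (simp add: \<sigma>3_def \<sigma>2_def enc_nat_def replicate_add)
  moreover have "runs 12 B (loop Y2 (loop M1 (advance {QT}))) \<sigma>3 \<sigma>4"
    using runs_loop2_advance[of Y2 12 y B "unary y @ [False]" \<sigma>3 M1 m "unary m" QT Q 1] assms bounds
    by (simp add: \<sigma>4_def \<sigma>3_def \<sigma>2_def \<sigma>1_def)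
  moreover have "runs 12 B (loop N1 lower_row_prog) \<sigma>4 (\<sigma>5 n)"
  proof (rule runs_loop[where S = \<sigma>5 and n = n and c = "unary n"])
    fix i assume i: "i < n"
    show "runs 12 B lower_row_prog ((\<sigma>5 i)(N1 := tape_at (unary n) (Suc i)))
        ((\<sigma>5 (Suc i))(N1 := tape_at (unary n) (Suc i)))"
      by (rule runs_eq, rule runs_lower_row[where a = i and out = "enc_nat (n + m) @ concat (map row [0..<i])"])
        (use assms i in \<open>auto simp: fun_eq_iff \<sigma>5_def \<sigma>4_def \<sigma>3_def \<sigma>2_def \<sigma>1_def\<close>)
  qed (use assms bounds in \<open>auto simp: fun_eq_iff \<sigma>5_def \<sigma>4_def \<sigma>3_def \<sigma>2_def \<sigma>1_def\<close>)
  moreover have "runs 12 B (rewind QT) (\<sigma>5 n) \<sigma>6"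
  proof -
    have "y * m \<le> m * m" using y by (intro mult_le_mono1) simp
    then have "Suc (y * m) \<le> B" using bounds by linarith
    then show ?thesis
      unfolding \<sigma>6_def
      by (intro runs_rewind[where h = "Suc (y * m)"]) (simp_all add: \<sigma>5_def \<sigma>4_def)
  qed
  moreover have "runs 12 B (loop M1 upper_row_prog) \<sigma>6 (\<sigma>7 m)"
  proof (rule runs_loop[where S = \<sigma>7 and n = m and c = "unary m"])
    fix i assume i: "i < m"
    show "runs 12 B upper_row_prog ((\<sigma>7 i)(M1 := tape_at (unary m) (Suc i)))
        ((\<sigma>7 (Suc i))(M1 := tape_at (unary m) (Suc i)))"
      by (rule runs_eq, rule runs_upper_row[where a = i and out = "enc_nat (n + m) @ concat (map row [0..<n + i])"])
        (use assms i in \<open>auto simp: fun_eq_iff \<sigma>7_def \<sigma>6_def \<sigma>5_def \<sigma>4_def \<sigma>3_def \<sigma>2_def \<sigma>1_def\<close>)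
  qed (use assms bounds in \<open>auto simp: fun_eq_iff \<sigma>7_def \<sigma>6_def \<sigma>5_def \<sigma>4_def \<sigma>3_def \<sigma>2_def \<sigma>1_def\<close>)
  \<comment> \<open>The label \<open>n + y\<close> of \<open>w\<close> is written as two runs of
    ones, driven by \<open>N1\<close> and \<open>Y2\<close>, closed by a single zero.\<close>
  moreover have "runs 12 B (loop N1 (emit {OUT} (\<lambda>_. 3) {})) (\<sigma>7 m) \<sigma>8"
    using runs_print_unary[of N1 n "unary n" "\<sigma>7 m" out] assms bounds by (simp add: defs out_def)
  moreover have "runs 12 B (loop Y2 (emit {OUT} (\<lambda>_. 3) {})) \<sigma>8 \<sigma>9"
    using runs_print_unary[of Y2 y "unary y @ [False]" \<sigma>8 "out @ unary n"] assms bounds by (simp add: defs)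
  moreover have "runs 12 B (emit {OUT} (\<lambda>_. 2) {}) \<sigma>9 \<sigma>10"
    using runs_print_False[of \<sigma>9 "out @ unary n @ unary y"]
    by (simp add: \<sigma>10_def \<sigma>9_def enc_nat_def replicate_add)
  moreover have "runs 12 B (loop N1 (emit {OUT} (\<lambda>_. 3) {})) \<sigma>10 \<sigma>11"
    using runs_print_unary[of N1 n "unary n" \<sigma>10 "out @ enc_nat (n + y)"] assms bounds by (simp add: defs)
  moreover have "runs 12 B (emit {OUT} (\<lambda>_. 2) {}) \<sigma>11 \<sigma>12"
    using runs_print_False[of \<sigma>11 "out @ enc_nat (n + y) @ unary n"]
    by (simp add: \<sigma>12_def \<sigma>11_def enc_nat_def)
  ultimately have "runs 12 B output_prog \<sigma> \<sigma>12"
    unfolding output_prog_def by (intro runs_Seq)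
  moreover have "\<sigma>12 OUT = full (enc_nat (n + m) @ concat (map row [0..<n + m]) @ enc_nat (n + y) @ enc_nat n)"
    by (simp add: \<sigma>12_def out_def)
  ultimately show ?thesis by blast
qed

private abbreviation (input) "input \<equiv> enc_nat n @ P @ enc_nat m @ Q @ enc_nat x @ enc_nat y"

private lemma runs_parse:
  "\<exists>\<sigma>. runs 12 B parse_prog (\<lambda>k. (tape_content (if k = 0 then input else []), 0)) \<sigma> \<and>
    \<sigma> N1 = tape_at (unary n) 1 \<and> \<sigma> N2 = tape_at (unary n) 1 \<and> \<sigma> N3 = tape_at (unary n) 1 \<and>
    \<sigma> M1 = tape_at (unary m) 1 \<and> \<sigma> M2 = tape_at (unary m) 1 \<and>
    \<sigma> PT = tape_at P 1 \<and> \<sigma> QT = tape_at Q 1 \<and> \<sigma> XT = tape_at (unary x @ [False]) 1 \<and>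
    \<sigma> Y1 = tape_at (unary y @ [False]) 1 \<and> \<sigma> Y2 = tape_at (unary y @ [False]) 1 \<and> \<sigma> OUT = full []"
proof -
  let ?u1 = "enc_nat n" let ?u2 = "enc_nat n @ P" let ?u3 = "enc_nat n @ P @ enc_nat m"
  let ?u4 = "enc_nat n @ P @ enc_nat m @ Q" let ?u5 = "enc_nat n @ P @ enc_nat m @ Q @ enc_nat x"
  define w where "w = input"
  define \<sigma>0 :: "nat \<Rightarrow> tape" where "\<sigma>0 = (\<lambda>k. (tape_content (if k = 0 then w else []), 0))"
  define \<sigma>1 where "\<sigma>1 = (\<lambda>k :: nat. if k < 12 then tape_at (if k = 0 then w else []) 1 else tape_at [] 0)"
  define \<sigma>2 where "\<sigma>2 = (\<lambda>k. if k \<in> {N1, N2, N3} then full (unary n)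
    else if k = IN then tape_at w (Suc n) else \<sigma>1 k)"
  define \<sigma>3 where "\<sigma>3 = \<sigma>2(IN := tape_at w (Suc (length ?u1)))"
  define \<sigma>4 where "\<sigma>4 = \<sigma>3(N1 := tape_at (unary n) 1)"
  define \<sigma>5 where "\<sigma>5 = \<sigma>4(N2 := tape_at (unary n) 1)"
  define \<sigma>6 where "\<sigma>6 = \<sigma>5(N3 := tape_at (unary n) 1)"
  define \<sigma>7 where "\<sigma>7 = \<sigma>6(IN := tape_at w (Suc (length ?u2)), PT := full P)"
  define \<sigma>8 where "\<sigma>8 = \<sigma>7(PT := tape_at P 1)"
  define \<sigma>9 where "\<sigma>9 = (\<lambda>k. if k \<in> {M1, M2} then full (unary m)
    else if k = IN then tape_at w (Suc (length ?u2 + m)) else \<sigma>8 k)"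
  define \<sigma>10 where "\<sigma>10 = \<sigma>9(IN := tape_at w (Suc (length ?u3)))"
  define \<sigma>11 where "\<sigma>11 = \<sigma>10(M1 := tape_at (unary m) 1)"
  define \<sigma>12 where "\<sigma>12 = \<sigma>11(M2 := tape_at (unary m) 1)"
  define \<sigma>13 where "\<sigma>13 = \<sigma>12(IN := tape_at w (Suc (length ?u4)), QT := full Q)"
  define \<sigma>14 where "\<sigma>14 = \<sigma>13(QT := tape_at Q 1)"
  define \<sigma>15 where "\<sigma>15 = (\<lambda>k. if k \<in> {XT} then full (unary x)
    else if k = IN then tape_at w (Suc (length ?u4 + x)) else \<sigma>14 k)"
  define \<sigma>16 where "\<sigma>16 = \<sigma>15(IN := tape_at w (Suc (length ?u5)), XT := full (unary x @ [False]))"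
  define \<sigma>17 where "\<sigma>17 = \<sigma>16(XT := tape_at (unary x @ [False]) 1)"
  define \<sigma>18 where "\<sigma>18 = (\<lambda>k. if k \<in> {Y1, Y2} then full (unary y)
    else if k = IN then tape_at w (Suc (length ?u5 + y)) else \<sigma>17 k)"
  define \<sigma>19 where "\<sigma>19 = \<sigma>18(IN := tape_at w (Suc (length input)),
    Y1 := full (unary y @ [False]), Y2 := full (unary y @ [False]))"
  define \<sigma>20 where "\<sigma>20 = \<sigma>19(Y1 := tape_at (unary y @ [False]) 1)"
  define \<sigma>21 where "\<sigma>21 = \<sigma>20(Y2 := tape_at (unary y @ [False]) 1)"
  note defs = \<sigma>1_def \<sigma>2_def \<sigma>3_def \<sigma>4_def \<sigma>5_def \<sigma>6_def \<sigma>7_def \<sigma>8_def \<sigma>9_def \<sigma>10_def \<sigma>11_def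
    \<sigma>12_def \<sigma>13_def \<sigma>14_def \<sigma>15_def \<sigma>16_def \<sigma>17_def \<sigma>18_def \<sigma>19_def \<sigma>20_def \<sigma>21_def
  have len: "length (enc_nat k) = Suc k" for k by (simp add: enc_nat_def)
  have "runs 12 B (advance {..<12}) \<sigma>0 \<sigma>1"
    by (rule runs_eq[OF runs_advance]) (auto simp: fun_eq_iff \<sigma>0_def \<sigma>1_def adv_def tape_at_def)
  moreover have "runs 12 B (read_unary {N1, N2, N3}) \<sigma>1 \<sigma>2"
    by (rule runs_eq, rule runs_read_unary[where w = w and u = "[]" and n = n
        and v = "P @ enc_nat m @ Q @ enc_nat x @ enc_nat y"])
      (use bounds in \<open>auto simp: fun_eq_iff \<sigma>2_def \<sigma>1_def w_def enc_nat_def\<close>)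
  moreover have "runs 12 B (advance {IN}) \<sigma>2 \<sigma>3"
    by (rule runs_eq, rule runs_advance1[where v = w and h = "Suc n"]) (simp_all add: \<sigma>3_def \<sigma>2_def len)
  moreover have "runs 12 B (rewind N1) \<sigma>3 \<sigma>4"
    unfolding \<sigma>4_def using bounds by (intro runs_rewind[where h = "Suc n"]) (simp_all add: \<sigma>3_def \<sigma>2_def)
  moreover have "runs 12 B (rewind N2) \<sigma>4 \<sigma>5"
    unfolding \<sigma>5_def using bounds by (intro runs_rewind[where h = "Suc n"]) (simp_all add: \<sigma>4_def \<sigma>3_def \<sigma>2_def)
  moreover have "runs 12 B (rewind N3) \<sigma>5 \<sigma>6"
    unfolding \<sigma>6_def using bounds
    by (intro runs_rewind[where h = "Suc n"]) (simp_all add: \<sigma>5_def \<sigma>4_def \<sigma>3_def \<sigma>2_def)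
  moreover have "runs 12 B (loop N1 (loop N2 (emit {PT} (\<lambda>r. r IN) {IN}))) \<sigma>6 \<sigma>7"
    using bounds
    by (intro runs_eq[OF runs_loop2_copy[where n = n and n' = n and c = "unary n" and c' = "unary n"
          and w = w and u = ?u1 and u' = "enc_nat m @ Q @ enc_nat x @ enc_nat y" and bs = P]])
      (simp_all add: \<sigma>7_def \<sigma>6_def \<sigma>5_def \<sigma>4_def \<sigma>3_def \<sigma>2_def \<sigma>1_def w_def)
  moreover have "runs 12 B (rewind PT) \<sigma>7 \<sigma>8"
    unfolding \<sigma>8_def using bounds by (intro runs_rewind[where h = "Suc (n * n)"]) (simp_all add: \<sigma>7_def)
  moreover have "runs 12 B (read_unary {M1, M2}) \<sigma>8 \<sigma>9"
    by (rule runs_eq, rule runs_read_unary[where w = w and u = ?u2 and n = m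
        and v = "Q @ enc_nat x @ enc_nat y"])
      (use bounds in \<open>auto simp: fun_eq_iff \<sigma>9_def \<sigma>8_def \<sigma>7_def \<sigma>6_def \<sigma>5_def \<sigma>4_def \<sigma>3_def \<sigma>2_def \<sigma>1_def
        w_def enc_nat_def\<close>)
  moreover have "runs 12 B (advance {IN}) \<sigma>9 \<sigma>10"
    by (rule runs_eq, rule runs_advance1[where v = w and h = "Suc (length ?u2 + m)"])
      (simp_all add: \<sigma>10_def \<sigma>9_def len add.assoc)
  moreover have "runs 12 B (rewind M1) \<sigma>10 \<sigma>11"
    unfolding \<sigma>11_def using bounds by (intro runs_rewind[where h = "Suc m"]) (simp_all add: \<sigma>10_def \<sigma>9_def)
  moreover have "runs 12 B (rewind M2) \<sigma>11 \<sigma>12"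
    unfolding \<sigma>12_def using bounds
    by (intro runs_rewind[where h = "Suc m"]) (simp_all add: \<sigma>11_def \<sigma>10_def \<sigma>9_def)
  moreover have "runs 12 B (loop M1 (loop M2 (emit {QT} (\<lambda>r. r IN) {IN}))) \<sigma>12 \<sigma>13"
    using bounds
    by (intro runs_eq[OF runs_loop2_copy[where n = m and n' = m and c = "unary m" and c' = "unary m"
          and w = w and u = ?u3 and u' = "enc_nat x @ enc_nat y" and bs = Q]])
      (simp_all add: defs w_def add.assoc)
  moreover have "runs 12 B (rewind QT) \<sigma>13 \<sigma>14"
    unfolding \<sigma>14_def using bounds by (intro runs_rewind[where h = "Suc (m * m)"]) (simp_all add: \<sigma>13_def)
  moreover have "runs 12 B (read_unary {XT}) \<sigma>14 \<sigma>15"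
    by (rule runs_eq, rule runs_read_unary[where w = w and u = ?u4 and n = x and v = "enc_nat y"])
      (use bounds in \<open>auto simp: fun_eq_iff defs w_def enc_nat_def\<close>)
  moreover have "runs 12 B (emit {XT} (\<lambda>_. 2) {IN}) \<sigma>15 \<sigma>16"
    by (rule runs_eq, rule runs_emit[where v = "\<lambda>_. unary x" and b = False])
      (auto simp: fun_eq_iff \<sigma>16_def \<sigma>15_def len add.assoc bit_symbol_def)
  moreover have "runs 12 B (rewind XT) \<sigma>16 \<sigma>17"
    unfolding \<sigma>17_def using bounds x by (intro runs_rewind[where h = "Suc (Suc x)"]) (simp_all add: \<sigma>16_def)
  moreover have "runs 12 B (read_unary {Y1, Y2}) \<sigma>17 \<sigma>18"
    by (rule runs_eq, rule runs_read_unary[where w = w and u = ?u5 and n = y and v = "[]"])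
      (use bounds in \<open>auto simp: fun_eq_iff defs w_def enc_nat_def\<close>)
  moreover have "runs 12 B (emit {Y1, Y2} (\<lambda>_. 2) {IN}) \<sigma>18 \<sigma>19"
    by (rule runs_eq, rule runs_emit[where v = "\<lambda>_. unary y" and b = False])
      (auto simp: fun_eq_iff \<sigma>19_def \<sigma>18_def len add.assoc bit_symbol_def)
  moreover have "runs 12 B (rewind Y1) \<sigma>19 \<sigma>20"
    unfolding \<sigma>20_def using bounds y by (intro runs_rewind[where h = "Suc (Suc y)"]) (simp_all add: \<sigma>19_def)
  moreover have "runs 12 B (rewind Y2) \<sigma>20 \<sigma>21"
    unfolding \<sigma>21_def using bounds y
    by (intro runs_rewind[where h = "Suc (Suc y)"]) (simp_all add: \<sigma>20_def \<sigma>19_def)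
  ultimately have "runs 12 B parse_prog \<sigma>0 \<sigma>21"
    unfolding parse_prog_def by (intro runs_Seq)
  then have "runs 12 B parse_prog (\<lambda>k. (tape_content (if k = 0 then input else []), 0)) \<sigma>21"
    unfolding \<sigma>0_def w_def .
  then show ?thesis
    by (intro exI[of _ \<sigma>21] conjI) (simp_all add: defs)
qed

lemma runs_parse_output:
  "\<exists>\<sigma>. runs 12 B (parse_prog ;; output_prog)
      (\<lambda>k. (tape_content (if k = 0 then enc_nat n @ matrix_bits n ltP @ enc_nat m @ matrix_bits m ltQ @
        enc_nat x @ enc_nat y else []), 0)) \<sigma> \<and>
    fst (\<sigma> 11) = tape_content (enc_nat (n + m) @
      concat (map (\<lambda>a. map (glued_less n ltP ltQ x y a) [0..<n + m]) [0..<n + m]) @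
      enc_nat (n + y) @ enc_nat n)"
proof -
  obtain \<sigma> where \<sigma>: "runs 12 B parse_prog (\<lambda>k. (tape_content (if k = 0 then input else []), 0)) \<sigma>"
    "\<sigma> N1 = tape_at (unary n) 1" "\<sigma> N2 = tape_at (unary n) 1" "\<sigma> N3 = tape_at (unary n) 1"
    "\<sigma> M1 = tape_at (unary m) 1" "\<sigma> M2 = tape_at (unary m) 1"
    "\<sigma> PT = tape_at P 1" "\<sigma> QT = tape_at Q 1" "\<sigma> XT = tape_at (unary x @ [False]) 1"
    "\<sigma> Y1 = tape_at (unary y @ [False]) 1" "\<sigma> Y2 = tape_at (unary y @ [False]) 1" "\<sigma> OUT = full []"
    using runs_parse by blast
  from runs_output[OF \<sigma>(2-12)] obtain \<sigma>' where "runs 12 B output_prog \<sigma> \<sigma>'"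
    and "\<sigma>' OUT = full (enc_nat (n + m) @ concat (map row [0..<n + m]) @ enc_nat (n + y) @ enc_nat n)"
    by blast
  with runs_Seq[OF \<sigma>(1)] show ?thesis
    by (intro exI[of _ \<sigma>']) (simp add: tape_at_def)
qed

end

section \<open>The reduction: polynomial time and correctness\<close>

definition reduction :: "nat poset \<times> nat poset \<times> nat \<times> nat \<Rightarrow> nat poset \<times> nat \<times> nat" where
  "reduction = (\<lambda>(P, Q, x, y). let n = card (fst P); m = card (fst Q) in
     (({..<n + m}, glued_rel n m (snd P) (snd Q) x y), n + y, n))"

lemma enc_reduction:
  "enc_flatle (reduction (({..<n}, ltP), ({..<m}, ltQ), x, y)) =
    enc_nat (n + m) @ concat (map (\<lambda>a. map (glued_less n ltP ltQ x y a) [0..<n + m]) [0..<n + m]) @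
    enc_nat (n + y) @ enc_nat n"
proof -
  have "map (\<lambda>b. (a, b) \<in> glued_rel n m ltP ltQ x y) [0..<n + m] = map (glued_less n ltP ltQ x y a) [0..<n + m]"
    if "a < n + m" for a
    using that by (intro map_cong) (auto simp: glued_rel_def)
  then have "map (\<lambda>a. map (\<lambda>b. (a, b) \<in> glued_rel n m ltP ltQ x y) [0..<n + m]) [0..<n + m] =
      map (\<lambda>a. map (glued_less n ltP ltQ x y a) [0..<n + m]) [0..<n + m]"
    by (intro map_cong) auto
  then show ?thesis
    by (simp only: enc_flatle_def reduction_def enc_poset_def Let_def prod.case fst_conv snd_conv
        card_lessThan append_assoc)
qed

lemma reduction_poly_time: "poly_time_computable crle_instances enc_crle enc_flatle reduction"
proof -
  let ?p = "parse_prog ;; output_prog"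
  obtain c d where cd: "\<And>B. cost ?p B \<le> c * B ^ d + c"
    using cost_polynomial by blast
  \<comment> \<open>The factor \<open>2 ^ d\<close> turns the bound in \<open>Suc l\<close> into one
    in the input length \<open>l\<close>, by \<open>Suc l \<le> 2 * l\<close> for
    \<open>l \<ge> 1\<close>.\<close>
  define C where "C = c * 2 ^ d"
  have "tm_outputs_within (prog_tm 12 ?p) (enc_crle a) (enc_flatle (reduction a))
      (C * length (enc_crle a) ^ d + C)" if "a \<in> crle_instances" for a
  proof -
    obtain n m ltP ltQ x y where a: "a = (({..<n}, ltP), ({..<m}, ltQ), x, y)" and xy: "x < n" "y < m"
    proof -
      obtain X ltP Y ltQ x y where a: "a = ((X, ltP), (Y, ltQ), x, y)" by (metis prod.collapse)
      then show thesis
        using that \<open>a \<in> crle_instances\<close>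
        by (auto simp: crle_instances_def labelled_poset_def min_elems_def)
    qed
    have enc: "enc_crle a = enc_nat n @ matrix_bits n ltP @ enc_nat m @ matrix_bits m ltQ @ enc_nat x @ enc_nat y"
      by (simp add: a enc_crle_def enc_poset_def Let_def matrix_bits_def)
    let ?l = "length (enc_crle a)"
    \<comment> \<open>The encoding contains both matrices literally, so \<open>Suc ?l\<close> can
      serve as \<open>B\<close>.\<close>
    have l: "?l \<ge> 1" "n * n + 1 \<le> Suc ?l" "m * m + 1 \<le> Suc ?l"
      unfolding enc by (simp_all add: enc_nat_def)
    obtain \<sigma> where "runs 12 (Suc ?l) ?p (\<lambda>k. (tape_content (if k = 0 then enc_crle a else []), 0)) \<sigma>"
      and out: "fst (\<sigma> 11) = tape_content (enc_flatle (reduction a))"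
      using runs_parse_output[OF xy l(2,3), of ltP ltQ] unfolding enc[symmetric] enc_reduction[symmetric] a[symmetric]
      by blast
    then obtain t where t: "t \<le> cost ?p (Suc ?l)"
      and run: "exec 12 ?p (\<lambda>k. (tape_content (if k = 0 then enc_crle a else []), 0)) t \<sigma>"
      unfolding runs_def by blast
    have "Suc ?l ^ d \<le> (2 * ?l) ^ d"
      using l(1) by (intro power_mono) simp_all
    from mult_le_mono2[OF this, of c] have "cost ?p (Suc ?l) \<le> c * (2 * ?l) ^ d + c"
      by (intro order_trans[OF cd] add_le_mono1)
    also have "\<dots> = C * ?l ^ d + c" by (simp add: C_def power_mult_distrib)
    also have "c \<le> C" by (simp add: C_def)
    finally have "t \<le> C * ?l ^ d + C" using t by simp
    then show ?thesis
      using out by (intro prog_tm_outputs_within[OF run]) simp_all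
  qed
  moreover have "wf_tm (prog_tm 12 ?p)"
    by (intro wf_prog_tm wf_prog_parse_output) simp
  ultimately show ?thesis
    unfolding poly_time_computable_def by blast
qed

lemma reduction_correct:
  assumes "labelled_poset n P" "labelled_poset m Q" "x \<in> min_elems P" "y \<in> min_elems Q"
    and "reduction (P, Q, x, y) = (R, z, c)"
  shows "labelled_poset (m + n) R" "z \<in> fst R" "c \<in> {1..m + n}"
    "num_lin_exts_at R z c = num_lin_exts_at R z (c + 1) \<longleftrightarrow> rho P x = rho Q y"
proof -
  obtain ltP ltQ where PQ: "P = ({..<n}, ltP)" "Q = ({..<m}, ltQ)"
    using assms(1,2) by (cases P; cases Q) (auto simp: labelled_poset_def)
  have fin: "finite_poset ({..<n}, ltP)" "finite_poset ({..<m}, ltQ)"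
    using assms(1,2) by (auto simp: labelled_poset_def PQ)
  have min: "x \<in> min_elems ({..<n}, ltP)" "y \<in> min_elems ({..<m}, ltQ)"
    using assms(3,4) by (auto simp: PQ)
  then have xy: "x < n" "y < m" by (auto simp: min_elems_def)
  have R: "R = ({..<n + m}, glued_rel n m ltP ltQ x y)" "z = n + y" "c = n"
    using assms(5) by (auto simp: reduction_def PQ Let_def)
  show "labelled_poset (m + n) R"
    using finite_poset_glued[OF fin min] by (simp add: labelled_poset_def R add.commute)
  show "z \<in> fst R" "c \<in> {1..m + n}" using xy by (auto simp: R)
  show "num_lin_exts_at R z c = num_lin_exts_at R z (c + 1) \<longleftrightarrow> rho P x = rho Q y"
    unfolding R PQ by (rule rho_eq_iff_glued[OF fin min])
qed

text \<open>\<open>reduction\<close> witnesses both conjuncts; the second also records the size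
  \<open>m + n\<close> of the constructed poset, which \<open>poly_time_reduces\<close> does not
  express.\<close>

theorem theorem7p1:
  "poly_time_reduces CRLE FlatLE0 \<and>
   (\<exists>F :: nat poset \<times> nat poset \<times> nat \<times> nat \<Rightarrow> nat poset \<times> nat \<times> nat.
      poly_time_computable (instances CRLE) (encoding CRLE) (encoding FlatLE0) F \<and>
      (\<forall>n m P Q x y.
         labelled_poset n P \<longrightarrow> labelled_poset m Q \<longrightarrow>
         x \<in> min_elems P \<longrightarrow> y \<in> min_elems Q \<longrightarrow>
         (\<exists>R z c. F (P, Q, x, y) = (R, z, c) \<and>
            labelled_poset (m + n) R \<and> z \<in> fst R \<and> c \<in> {1..m + n} \<and>
            (num_lin_exts_at R z c = num_lin_exts_at R z (c + 1) \<longleftrightarrow> rho P x = rho Q y))))"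
proof
  have poly: "poly_time_computable (instances CRLE) (encoding CRLE) (encoding FlatLE0) reduction"
    using reduction_poly_time by (simp add: CRLE_def FlatLE0_def)
  have "reduction a \<in> instances FlatLE0 \<and> (reduction a \<in> yes_instances FlatLE0 \<longleftrightarrow> a \<in> yes_instances CRLE)"
    if a: "a \<in> instances CRLE" for a
  proof -
    obtain P Q x y where a': "a = (P, Q, x, y)" by (metis prod_cases4)
    obtain R z c where red: "reduction a = (R, z, c)" by (metis prod_cases3)
    from a obtain n m where "labelled_poset n P" "labelled_poset m Q" "x \<in> min_elems P" "y \<in> min_elems Q"
      by (auto simp: CRLE_def crle_instances_def a')
    from reduction_correct[OF this red[unfolded a']] a show ?thesis
      unfolding red by (auto simp: CRLE_def FlatLE0_def flatle_instances_def a')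
  qed
  with poly show "poly_time_reduces CRLE FlatLE0"
    unfolding poly_time_reduces_def by blast
  show "\<exists>F. poly_time_computable (instances CRLE) (encoding CRLE) (encoding FlatLE0) F \<and>
      (\<forall>n m P Q x y.
         labelled_poset n P \<longrightarrow> labelled_poset m Q \<longrightarrow>
         x \<in> min_elems P \<longrightarrow> y \<in> min_elems Q \<longrightarrow>
         (\<exists>R z c. F (P, Q, x, y) = (R, z, c) \<and>
            labelled_poset (m + n) R \<and> z \<in> fst R \<and> c \<in> {1..m + n} \<and>
            (num_lin_exts_at R z c = num_lin_exts_at R z (c + 1) \<longleftrightarrow> rho P x = rho Q y)))"
  proof (intro exI[of _ reduction] conjI poly allI impI)
    fix n m P Q x y
    assume "labelled_poset n P" "labelled_poset m Q" "x \<in> min_elems P" "y \<in> min_elems Q"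
    moreover obtain R z c where red: "reduction (P, Q, x, y) = (R, z, c)" by (metis prod_cases3)
    ultimately show "\<exists>R z c. reduction (P, Q, x, y) = (R, z, c) \<and>
        labelled_poset (m + n) R \<and> z \<in> fst R \<and> c \<in> {1..m + n} \<and>
        (num_lin_exts_at R z c = num_lin_exts_at R z (c + 1) \<longleftrightarrow> rho P x = rho Q y)"
      using reduction_correct[OF _ _ _ _ red] by blast
  qed
qed

end
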